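(* Let $F\in\mathsf{MDA}(\gamma)$, $\gamma>0$, satisfy the von Mises condition with bounded von Mises function $\eta$, and let $\overline\eta(t)=\sup_{s\ge t}|\eta(s)|$. Let $1\le k<n$ and let $\widehat\gamma(k)=\frac1k\sum_{i=1}^k\ln\frac{X_{(i)}}{X_{(k+1)}}$ be the Hill estimator computed from the $(k+1)$ largest order statistics $X_{(1)}\ge\dots\ge X_{(k+1)}$ of an $n$-sample from $F$. Let $Y_{(k+1)}$ be the $(k+1)$th largest order statistic of a sample of $n$ independent standard exponential random variables. Then $$-\frac{2\gamma}{k}\,\mathbb{E}\left[\overline\eta\big(e^{Y_{(k+1)}}\big)\right]\ \le\ \operatorname{Var}[\widehat\gamma(k)]-\frac{\gamma^2}{k}\ \le\ \frac{2\gamma}{k}\,\mathbb{E}\left[\overline\eta\big(e^{Y_{(k+1)}}\big)\right]+\frac5k\,\mathbb{E}\left[\overline\eta\big(e^{Y_{(k+1)}}\big)^2\right].$$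
   Context: $F\in\mathsf{MDA}(\gamma)$, $\gamma>0$, means that $\overline{F}=1-F$ is regularly varying at infinity: $\overline F(\tau x)/\overline F(\tau)\to x^{-1/\gamma}$ as $\tau\to\infty$ for all $x>0$. The tail quantile function is $U(t)=\inf\{x: F(x)\ge 1-1/t\}$, $t>1$. $F$ satisfies the von Mises condition (with $t_0=1$) with von Mises function $\eta$ if there are a constant $c>0$ and a measurable function $\eta$ on $(1,\infty)$ with $\lim_{s\to\infty}\eta(s)=0$ such that $U(t)=c\,t^{\gamma}\exp\left(\int_1^t \frac{\eta(s)}{s}\,ds\right)$ for $t\geq 1$. The function $\overline\eta$ is defined on $[1,\infty)$, and $\overline\eta(1)<\infty$. *)

theory Defs
  imports "HOL-Probability.Probability"
begin

definition MDA :: "real \<Rightarrow> (real \<Rightarrow> real) \<Rightarrow> bool" where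
  "MDA \<gamma> F \<longleftrightarrow>
     (\<forall>x>0. ((\<lambda>\<tau>. (1 - F (\<tau> * x)) / (1 - F \<tau>)) \<longlongrightarrow> x powr (- 1 / \<gamma>)) at_top)"

text \<open>Only meaningful for \<open>t > 1\<close>: at \<open>t = 1\<close> the set is unbounded below.\<close>

definition tail_quantile :: "(real \<Rightarrow> real) \<Rightarrow> real \<Rightarrow> real" where
  "tail_quantile F t = Inf {x. F x \<ge> 1 - 1 / t}"

text \<open>The von Mises function \<open>\<eta>\<close> lives on \<open>(1, \<infinity>)\<close>; its values elsewhere are irrelevant.
  The representation is required for \<open>t > 1\<close>, where the tail quantile function is defined. It forces
  \<open>U(t) \<rightarrow> c\<close> as \<open>t \<down> 1\<close>, so at \<open>t = 1\<close> it only amounts to the convention \<open>U(1) = U(1+)\<close>.\<close>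

definition von_mises :: "(real \<Rightarrow> real) \<Rightarrow> real \<Rightarrow> (real \<Rightarrow> real) \<Rightarrow> bool" where
  "von_mises F \<gamma> \<eta> \<longleftrightarrow>
     \<eta> \<in> borel_measurable (restrict_space borel {1<..}) \<and>
     (\<eta> \<longlongrightarrow> 0) at_top \<and>
     (\<forall>t>1. set_integrable lborel {1<..t} (\<lambda>s. \<eta> s / s)) \<and>
     (\<exists>c>0. \<forall>t>1. tail_quantile F t = c * t powr \<gamma> * exp (LBINT s:{1<..t}. \<eta> s / s))"

text \<open>The supremum ranges over the domain of \<open>\<eta>\<close>, so at \<open>t = 1\<close> it is taken over \<open>s > 1\<close>.
  It is a supremum of reals, hence only meaningful when \<open>\<eta>\<close> is bounded on \<open>[t, \<infinity>) \<inter> (1, \<infinity>)\<close>.\<close>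

definition eta_bar :: "(real \<Rightarrow> real) \<Rightarrow> real \<Rightarrow> real" where
  "eta_bar \<eta> t = (SUP s \<in> {t..} \<inter> {1<..}. \<bar>\<eta> s\<bar>)"

text \<open>\<open>order_stat n X j\<close> is the \<open>j\<close>-th largest of \<open>X 0, \<dots>, X (n - 1)\<close>, for \<open>1 \<le> j \<le> n\<close>.\<close>

definition order_stat :: "nat \<Rightarrow> (nat \<Rightarrow> 'a \<Rightarrow> real) \<Rightarrow> nat \<Rightarrow> 'a \<Rightarrow> real" where
  "order_stat n X j \<omega> = rev (sort (map (\<lambda>i. X i \<omega>) [0..<n])) ! (j - 1)"

definition hill :: "nat \<Rightarrow> (nat \<Rightarrow> 'a \<Rightarrow> real) \<Rightarrow> nat \<Rightarrow> 'a \<Rightarrow> real" where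
  "hill n X k \<omega> =
     1 / real k * (\<Sum>i=1..k. ln (order_stat n X i \<omega> / order_stat n X (k + 1) \<omega>))"

end

theory Submission
  imports Defs
begin

text \<open>
  In terms of standard exponential variables, \<open>X\<^sub>i = U(exp Y\<^sub>i)\<close> with
  \<open>ln U(exp y) = ln c + \<gamma> y + G y\<close>, where \<open>G' y = \<zeta> y = \<eta>(exp y)\<close>. By Renyi's representation, given
  \<open>Y\<^sub>(\<^sub>k\<^sub>+\<^sub>1\<^sub>) = t\<close> the Hill estimator is the mean of \<open>k\<close> independent copies of
  \<open>\<gamma> Z + G (t + Z) - G t\<close> with \<open>Z\<close> standard exponential. Writing \<open>b t\<close> for the supremum
  of \<open>\<bar>\<eta>\<bar>\<close> beyond \<open>exp t\<close>, the perturbation \<open>G (t + Z) - G t\<close> is \<open>b t\<close>-Lipschitz in \<open>Z\<close>,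
  so the conditional variance lies within \<open>2 \<gamma> b / k\<close> below and \<open>(2 \<gamma> b + b\<^sup>2) / k\<close> above \<open>\<gamma>\<^sup>2 / k\<close>.

  The conditional mean is \<open>\<gamma> + m t\<close>, with \<open>m\<close> having slope at most \<open>2 b\<close>, and it remains to show that
  \<open>m(Y\<^sub>(\<^sub>k\<^sub>+\<^sub>1\<^sub>))\<close> has variance at most \<open>4 / k\<close> times the mean of \<open>b\<^sup>2\<close>.
  By the Cauchy-Schwarz inequality with weight \<open>exp\<close>, \<open>(m y - m x)\<^sup>2 \<le> 4 (exp y - exp x) (Q y - Q x)\<close> where
  \<open>Q' = b\<^sup>2 exp(-u)\<close>. Taking \<open>exp x = n / k\<close>, the mean of \<open>exp Y\<^sub>(\<^sub>k\<^sub>+\<^sub>1\<^sub>)\<close>, the variance is at most four times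
  the covariance of \<open>exp Y\<^sub>(\<^sub>k\<^sub>+\<^sub>1\<^sub>)\<close> and \<open>Q(Y\<^sub>(\<^sub>k\<^sub>+\<^sub>1\<^sub>))\<close>. For the density \<open>p\<close> of \<open>Y\<^sub>(\<^sub>k\<^sub>+\<^sub>1\<^sub>)\<close> one has
  \<open>((exp u - 1) p u)' = (n - k exp u) p u\<close>, so an integration by parts bounds this covariance by \<open>1 / k\<close>
  times the mean of \<open>b\<^sup>2\<close>.
\<close>

section \<open>Order statistics\<close>

text \<open>In a decreasing list the entries above a level form an initial segment, so a position
  lies in it exactly when it is smaller than the length of that segment.\<close>

lemma nth_greater_iff_length_filter:
  fixes ys :: "real list"
  assumes "sorted (rev ys)" "j < length ys"
  shows "a < ys ! j \<longleftrightarrow> j < length (filter (\<lambda>y. a < y) ys)"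
proof
  have dec: "ys ! v \<le> ys ! u" if "u \<le> v" "v < length ys" for u v
    using assms(1) that by (simp add: sorted_rev_iff_nth_mono)
  show "j < length (filter (\<lambda>y. a < y) ys)" if "a < ys ! j"
  proof -
    have "filter (\<lambda>y. a < y) (take (Suc j) ys) = take (Suc j) ys"
      using dec that assms(2)
      by (auto simp: in_set_conv_nth intro!: filter_True) (meson less_Suc_eq_le less_le_trans)
    then have "length (filter (\<lambda>y. a < y) (take (Suc j) ys)) = Suc j"
      using assms(2) by simp
    moreover have "filter (\<lambda>y. a < y) ys
        = filter (\<lambda>y. a < y) (take (Suc j) ys) @ filter (\<lambda>y. a < y) (drop (Suc j) ys)"
      by (metis append_take_drop_id filter_append)
    ultimately show ?thesis by simp
  qed
  show "a < ys ! j" if less: "j < length (filter (\<lambda>y. a < y) ys)"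
  proof (rule ccontr)
    assume "\<not> a < ys ! j"
    then have "\<not> a < ys ! (j + u)" if "j + u < length ys" for u
      using dec[of j "j + u"] that by auto
    then have "filter (\<lambda>y. a < y) (drop j ys) = []"
      by (auto simp: filter_empty_conv in_set_conv_nth)
    moreover have "filter (\<lambda>y. a < y) ys
        = filter (\<lambda>y. a < y) (take j ys) @ filter (\<lambda>y. a < y) (drop j ys)"
      by (metis append_take_drop_id filter_append)
    ultimately have "length (filter (\<lambda>y. a < y) ys) \<le> j"
      by (metis append_Nil2 length_filter_le length_take min.cobounded2 order.trans)
    then show False using less by simp
  qed
qed

text \<open>Turns a statement about the sorted list into a count of exceedances, which no longer
  mentions sorting. The shift from \<open>j\<close> to \<open>j - 1\<close> comes from list
  positions starting at 0.\<close>

lemma order_stat_greater_iff: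
  assumes "1 \<le> j" "j \<le> n"
  shows "a < order_stat n X j \<omega> \<longleftrightarrow> j \<le> card {i \<in> {..<n}. a < X i \<omega>}"
proof -
  define xs where "xs = map (\<lambda>i. X i \<omega>) [0..<n]"
  have "length (filter (\<lambda>y. a < y) (rev (sort xs))) = length (filter (\<lambda>y. a < y) xs)"
    by (metis mset_filter mset_rev mset_sort size_mset)
  also have "\<dots> = length (filter (\<lambda>i. a < X i \<omega>) [0..<n])"
    by (simp add: xs_def filter_map comp_def)
  also have "\<dots> = card (set (filter (\<lambda>i. a < X i \<omega>) [0..<n]))"
    by (rule distinct_card[symmetric]) simp
  also have "set (filter (\<lambda>i. a < X i \<omega>) [0..<n]) = {i \<in> {..<n}. a < X i \<omega>}"
    by auto
  finally have len: "length (filter (\<lambda>y. a < y) (rev (sort xs))) = card {i \<in> {..<n}. a < X i \<omega>}" .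
  have "a < rev (sort xs) ! (j - 1) \<longleftrightarrow> j - 1 < length (filter (\<lambda>y. a < y) (rev (sort xs)))"
    using assms by (intro nth_greater_iff_length_filter) (auto simp: xs_def)
  then show ?thesis
    using assms(1) unfolding len by (auto simp: order_stat_def xs_def)
qed

lemma measurable_order_stat:
  assumes "\<And>i. i < n \<Longrightarrow> X i \<in> borel_measurable M" "1 \<le> j" "j \<le> n"
  shows "order_stat n X j \<in> borel_measurable M"
proof (subst borel_measurable_iff_greater, intro allI)
  fix a
  have [measurable]: "i \<in> {..<n} \<Longrightarrow> X i \<in> borel_measurable M" for i
    using assms(1) by simp
  \<comment> \<open>As a finite sum of indicators the count is visibly measurable.\<close>
  have "card {i \<in> {..<n}. a < X i \<omega>} = (\<Sum>i<n. if a < X i \<omega> then 1 else 0)" for \<omega>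
    by (simp add: sum.If_cases Int_def)
  then have "{\<omega> \<in> space M. a < order_stat n X j \<omega>}
      = {\<omega> \<in> space M. j \<le> (\<Sum>i<n. if a < X i \<omega> then 1 else (0::nat))}"
    using assms(2,3) by (simp add: order_stat_greater_iff)
  also have "\<dots> \<in> sets M"
    by measurable
  finally show "{\<omega> \<in> space M. a < order_stat n X j \<omega>} \<in> sets M" .
qed

text \<open>Monotonicity is asked for on a set \<open>A\<close> only: the quantile transform below
  is known to be nondecreasing just on the positive half-line, where exponential samples lie almost
  surely.\<close>

lemma order_stat_mono_map:
  assumes "mono_on A H" "\<And>i. i < n \<Longrightarrow> Y i \<omega> \<in> A" "1 \<le> j" "j \<le> n"
  shows "order_stat n (\<lambda>i \<omega>. H (Y i \<omega>)) j \<omega> = H (order_stat n Y j \<omega>)"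
proof -
  define xs where "xs = map (\<lambda>i. Y i \<omega>) [0..<n]"
  have set: "set xs \<subseteq> A"
    using assms(2) by (auto simp: xs_def)
  have "sorted (map H (sort xs))"
    unfolding sorted_map
    using sorted_wrt_mono_rel[of "sort xs" "(\<le>)" "\<lambda>x y. H x \<le> H y"] set assms(1)
    by (auto simp: mono_on_def subset_eq)
  then have "sort (map H xs) = map H (sort xs)"
    by (intro properties_for_sort) simp_all
  then have "sort (map (\<lambda>i. H (Y i \<omega>)) [0..<n]) = map H (sort xs)"
    by (simp add: xs_def comp_def)
  then show ?thesis
    using assms(3,4) by (simp add: order_stat_def xs_def rev_map)
qed

text \<open>The inequalities put the values outside \<open>S\<close> and \<open>i\<close> first in
  the sorted list, then the value at \<open>i\<close>, then those in \<open>S\<close>. The Hill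
  estimator sees the top \<open>k\<close> values only through a symmetric sum, so their order within
  \<open>S\<close> does not matter.\<close>

lemma order_stat_split:
  assumes i: "i < n" and S: "S \<subseteq> {..<n} - {i}" "card S = k"
    and above: "\<And>j. j \<in> S \<Longrightarrow> X i \<omega> < X j \<omega>"
    and below: "\<And>j. j \<in> {..<n} - {i} - S \<Longrightarrow> X j \<omega> < X i \<omega>"
  shows "order_stat n X (k + 1) \<omega> = X i \<omega>"
    and "(\<Sum>l=1..k. f (order_stat n X l \<omega>)) = (\<Sum>j\<in>S. f (X j \<omega>))"
proof -
  define R where "R = {..<n} - {i} - S"
  have fin: "finite S" "finite R"
    using S(1) finite_subset by (auto simp: R_def)
  define vs where "vs A = sorted_list_of_multiset (image_mset (\<lambda>j. X j \<omega>) (mset_set A))" for A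
  have mset_vs: "mset (vs A) = image_mset (\<lambda>j. X j \<omega>) (mset_set A)" for A
    by (simp add: vs_def)
  have set_vs: "set (vs A) = (\<lambda>j. X j \<omega>) ` A" if "finite A" for A
    using that by (simp add: vs_def)
  have len: "length (vs S) = k"
    using S(2) mset_vs[of S] by (metis size_image_mset size_mset size_mset_set)
  have "{..<n} = insert i (S \<union> R)" "i \<notin> S \<union> R" "S \<inter> R = {}"
    using i S(1) by (auto simp: R_def)
  then have "mset (vs R @ [X i \<omega>] @ vs S) = mset (map (\<lambda>i. X i \<omega>) [0..<n])"
    using fin by (simp add: mset_vs mset_set_Union lessThan_atLeast0)
  moreover have "sorted (vs R @ [X i \<omega>] @ vs S)"
    using above below fin unfolding sorted_append
    by (auto simp: set_vs R_def) (force simp: vs_def)+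
  ultimately have sort: "sort (map (\<lambda>i. X i \<omega>) [0..<n]) = vs R @ [X i \<omega>] @ vs S"
    by (intro properties_for_sort)
  show "order_stat n X (k + 1) \<omega> = X i \<omega>"
    using len by (simp add: order_stat_def sort nth_append)
  have "(\<Sum>l=1..k. f (order_stat n X l \<omega>)) = (\<Sum>l<k. f (rev (vs S) ! l))"
    using len by (simp add: sum.atLeast1_atMost_eq order_stat_def sort nth_append)
  also have "\<dots> = sum_list (map f (rev (vs S)))"
    using len by (simp add: sum_list_sum_nth atLeast0LessThan)
  also have "\<dots> = sum_list (map f (vs S))"
    by (metis rev_map sum_list_rev)
  also have "\<dots> = sum_mset (image_mset f (mset (vs S)))"
    by (metis mset_map sum_mset_sum_list)
  also have "\<dots> = (\<Sum>j\<in>S. f (X j \<omega>))"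
    by (simp add: mset_vs image_mset.compositionality comp_def sum_unfold_sum_mset)
  finally show "(\<Sum>l=1..k. f (order_stat n X l \<omega>)) = (\<Sum>j\<in>S. f (X j \<omega>))" .
qed

section \<open>Which observation is the (k+1)th largest, and which ones lie above it\<close>

definition splits :: "nat \<Rightarrow> nat \<Rightarrow> (nat \<times> nat set) set" where
  "splits n k = (SIGMA i:{..<n}. {S. S \<subseteq> {..<n} - {i} \<and> card S = k})"

lemma finite_splits: "finite (splits n k)"
  unfolding splits_def by (intro finite_SigmaI) auto

text \<open>For fixed \<open>(i, S)\<close> this is the event that observation \<open>i\<close> is
  the (k+1)th largest and that the \<open>k\<close> larger ones are exactly those in
  \<open>S\<close>. The strict inequalities rule out ties with observation \<open>i\<close>.\<close>

definition splits_at :: "nat \<Rightarrow> (nat \<Rightarrow> real) \<Rightarrow> nat \<times> nat set \<Rightarrow> bool" where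
  "splits_at n x = (\<lambda>(i, S). (\<forall>j\<in>S. x i < x j) \<and> (\<forall>j\<in>{..<n} - {i} - S. x j < x i))"

text \<open>Without ties the events indexed by \<open>splits n k\<close> partition the sample space.
  The rank, that is the number of larger values, is an injection of \<open>{..<n}\<close> into
  itself and hence a bijection; the index of rank \<open>k\<close> determines the pair.\<close>

lemma ex1_splits_at:
  assumes "inj_on x {..<n}" "k < n"
  shows "\<exists>!p. p \<in> splits n k \<and> splits_at n x p"
proof -
  define r where "r i = card {j \<in> {..<n}. x i < x j}" for i
  have mono: "r i < r l" if "x l < x i" "l < n" "i < n" for i l
    unfolding r_def using that by (intro psubset_card_mono) auto
  have "inj_on r {..<n}"
  proof (rule inj_onI)
    fix i l assume "i \<in> {..<n}" "l \<in> {..<n}" "r i = r l"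
    then show "i = l"
      using mono[of i l] mono[of l i] assms(1)
      by (metis inj_onD lessThan_iff less_irrefl linorder_neqE_linordered_idom)
  qed
  moreover have "r i < n" if "i < n" for i
  proof -
    have "r i < card {..<n}"
      unfolding r_def using that by (intro psubset_card_mono) auto
    then show ?thesis by simp
  qed
  then have "r ` {..<n} \<subseteq> {..<n}" by auto
  ultimately have "r ` {..<n} = {..<n}"
    by (intro endo_inj_surj) auto
  then obtain i where i: "i < n" "r i = k"
    using assms(2) by (metis imageE lessThan_iff)
  define S where "S = {j \<in> {..<n}. x i < x j}"
  have ne: "x i \<noteq> x j" if "j < n" "j \<noteq> i" for j
    using assms(1) i(1) that by (metis inj_onD lessThan_iff)
  show ?thesis
  proof (rule ex1I[of _ "(i, S)"])
    show "(i, S) \<in> splits n k \<and> splits_at n x (i, S)"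
      using i ne by (force simp: splits_def splits_at_def S_def r_def)
  next
    fix p assume p: "p \<in> splits n k \<and> splits_at n x p"
    obtain i' S' where [simp]: "p = (i', S')" by (cases p)
    have i': "i' < n" "S' \<subseteq> {..<n} - {i'}" "card S' = k"
      using p by (auto simp: splits_def)
    have "S' = {j \<in> {..<n}. x i' < x j}"
    proof (intro set_eqI iffI)
      show "j \<in> {j \<in> {..<n}. x i' < x j}" if "j \<in> S'" for j
        using p i'(2) that by (auto simp: splits_at_def)
      show "j \<in> S'" if j: "j \<in> {j \<in> {..<n}. x i' < x j}" for j
      proof (rule ccontr)
        assume "j \<notin> S'"
        then have "j \<in> {..<n} - {i'} - S'" using j by auto
        then have "x j < x i'" using p by (simp add: splits_at_def)
        then show False using j by simp
      qed
    qed
    moreover from this have "i' = i"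
      using i'(1,3) i \<open>inj_on r {..<n}\<close> by (auto simp: r_def inj_on_def)
    ultimately show "p = (i, S)" by (simp add: S_def)
  qed
qed

section \<open>Standard exponential samples\<close>

abbreviation std_exp :: "real measure" where
  "std_exp \<equiv> density lborel (exponential_density 1)"

lemma prob_space_std_exp: "prob_space std_exp"
  by (rule prob_space_exponential_density) simp

lemma integrable_exponential_density: "integrable lborel (exponential_density 1)"
proof -
  interpret prob_space std_exp by (rule prob_space_std_exp)
  have "integrable std_exp (\<lambda>_. 1 :: real)" by simp
  then show ?thesis
    by (subst (asm) integrable_density) auto
qed

text \<open>The point 0 is dropped from the support of \<open>exponential_density 1\<close> as a
  null set, so that the support matches the open half-lines of the memoryless property.\<close>

lemma nn_integral_std_exp:
  assumes [measurable]: "f \<in> borel_measurable borel"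
  shows "(\<integral>\<^sup>+z. f z \<partial>std_exp) = (\<integral>\<^sup>+z. ennreal (exp (- z)) * indicator {0<..} z * f z \<partial>lborel)"
proof -
  have "(\<integral>\<^sup>+z. f z \<partial>std_exp) = (\<integral>\<^sup>+z. ennreal (exponential_density 1 z) * f z \<partial>lborel)"
    by (subst nn_integral_density) simp_all
  also have "\<dots> = (\<integral>\<^sup>+z. ennreal (exp (- z)) * indicator {0<..} z * f z \<partial>lborel)"
    using AE_lborel_singleton[of "0::real"]
    by (intro nn_integral_cong_AE) (auto simp: exponential_density_def split: split_indicator)
  finally show ?thesis .
qed

lemma AE_std_exp_pos: "AE z in std_exp. 0 < z"
  using AE_lborel_singleton[of "0::real"]
  by (subst AE_density) (auto simp: exponential_density_def elim!: eventually_mono)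

lemma emeasure_std_exp_singleton: "emeasure std_exp {t} = 0"
proof -
  have "emeasure std_exp {t} = (\<integral>\<^sup>+z. ennreal (exponential_density 1 z) * indicator {t} z \<partial>lborel)"
    by (rule emeasure_density) simp_all
  also have "\<dots> = (\<integral>\<^sup>+z. 0 \<partial>(lborel::real measure))"
    using AE_lborel_singleton[of t] by (intro nn_integral_cong_AE) auto
  finally show ?thesis by simp
qed

lemma emeasure_std_exp_lessThan:
  assumes "0 \<le> t"
  shows "emeasure std_exp {..<t} = ennreal (1 - exp (- t))"
proof -
  have "emeasure std_exp {..t} = emeasure std_exp ({..<t} \<union> {t})"
    by (rule arg_cong[where f = "emeasure std_exp"]) auto
  also have "\<dots> = emeasure std_exp {..<t}"
    by (subst plus_emeasure[symmetric]) (auto simp: emeasure_std_exp_singleton)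
  finally show ?thesis
    using assms by (simp add: emeasure_erlang_density erlang_CDF_0)
qed

text \<open>The memoryless property, by the substitution z -> t + z: exceeding \<open>t\<close>
  costs the factor exp(-t), and the excess is again standard exponential.\<close>

lemma nn_integral_std_exp_shift:
  assumes [measurable]: "f \<in> borel_measurable borel" and "0 \<le> t"
  shows "(\<integral>\<^sup>+z. indicator {t<..} z * f z \<partial>std_exp) = ennreal (exp (- t)) * (\<integral>\<^sup>+z. f (t + z) \<partial>std_exp)"
proof -
  have "(\<integral>\<^sup>+z. indicator {t<..} z * f z \<partial>std_exp)
      = (\<integral>\<^sup>+z. ennreal (exp (- z)) * indicator {0<..} z * (indicator {t<..} z * f z) \<partial>lborel)"
    by (rule nn_integral_std_exp) simp
  also have "\<dots> = (\<integral>\<^sup>+z. ennreal (exp (- (t + z))) * indicator {0<..} (t + z) * (indicator {t<..} (t + z) * f (t + z)) \<partial>lborel)"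
    by (subst nn_integral_real_affine[where c = 1 and t = t]) simp_all
  also have "\<dots> = (\<integral>\<^sup>+z. ennreal (exp (- t)) * (ennreal (exp (- z)) * indicator {0<..} z * f (t + z)) \<partial>lborel)"
    using assms(2)
    by (intro nn_integral_cong) (auto simp: exp_add exp_minus ennreal_mult' mult_ac exp_diff divide_inverse split: split_indicator)
  also have "\<dots> = ennreal (exp (- t)) * (\<integral>\<^sup>+z. f (t + z) \<partial>std_exp)"
    by (simp add: nn_integral_cmult nn_integral_std_exp)
  finally show ?thesis .
qed

lemma nn_integral_std_exp_lessThan:
  assumes "0 \<le> t"
  shows "(\<integral>\<^sup>+z. indicator {..<t} z * c \<partial>std_exp) = ennreal (1 - exp (- t)) * c"
  using emeasure_std_exp_lessThan[OF assms] by (simp add: nn_integral_multc)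

text \<open>The coordinates are integrated out one at a time: one outside \<open>S\<close>
  contributes the probability 1 - exp(-t), one inside \<open>S\<close> is handled by memorylessness.
  \<open>F\<close> is generalised in the induction because fixing a coordinate of \<open>S\<close>
  at \<open>y\<close> replaces \<open>F\<close> by the function w -> F (D y + w).\<close>

lemma nn_integral_PiM_memoryless:
  fixes D :: "real \<Rightarrow> real" and F :: "real \<Rightarrow> ennreal"
  assumes "finite A" "S \<subseteq> A" "0 \<le> t"
    and [measurable]: "F \<in> borel_measurable borel" "D \<in> borel_measurable borel"
  shows "(\<integral>\<^sup>+x. (\<Prod>j\<in>A. indicator (if j \<in> S then {t<..} else {..<t}) (x j))
             * F (\<Sum>j\<in>S. D (x j)) \<partial>Pi\<^sub>M A (\<lambda>_. std_exp))
       = ennreal (exp (- t)) ^ card S * ennreal (1 - exp (- t)) ^ card (A - S)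
         * (\<integral>\<^sup>+z. F (\<Sum>j\<in>S. D (t + z j)) \<partial>Pi\<^sub>M S (\<lambda>_. std_exp))"
  using assms(1,2,4)
proof (induction A arbitrary: S F rule: finite_induct)
  case empty
  then show ?case by (simp add: space_PiM)
next
  case (insert a A)
  interpret product_prob_space "\<lambda>_. std_exp" UNIV
    by (intro product_prob_spaceI prob_space_std_exp)
  note [measurable] = insert.prems(2)
  have finS: "finite S"
    using insert by (meson finite_insert finite_subset)
  let ?I = "\<lambda>S j. indicator (if j \<in> S then {t<..} else {..<t}) :: real \<Rightarrow> ennreal"
  have sumD [measurable]: "(\<lambda>x. \<Sum>j\<in>S. D (x j)) \<in> borel_measurable (Pi\<^sub>M B (\<lambda>_. std_exp))" if "S \<subseteq> B" for S B
  proof (rule borel_measurable_sum)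
    fix j assume "j \<in> S"
    then have [measurable]: "j \<in> B" using that by auto
    show "(\<lambda>x. D (x j)) \<in> borel_measurable (Pi\<^sub>M B (\<lambda>_. std_exp))" by measurable
  qed
  have meas: "(\<lambda>x. (\<Prod>j\<in>insert a A. ?I S j (x j)) * F (\<Sum>j\<in>S. D (x j)))
      \<in> borel_measurable (Pi\<^sub>M (insert a A) (\<lambda>_. std_exp))"
    using sumD[OF insert.prems(1)] by (auto intro!: borel_measurable_times_ennreal borel_measurable_prod_ennreal
        measurable_compose[OF _ insert.prems(2)])
  have upd: "(\<Prod>j\<in>A. ?I S j ((x(a := y)) j)) = (\<Prod>j\<in>A. ?I (S - {a}) j (x j))" for x y
    using insert.hyps(2) by (intro prod.cong) auto
  have sum_upd: "(\<Sum>j\<in>S - {a}. D ((x(a := y)) j)) = (\<Sum>j\<in>S - {a}. D (x j))" for x y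
    by (intro sum.cong) auto
  show ?case
  proof (cases "a \<in> S")
    case True
    define S' where "S' = S - {a}"
    have S': "S = insert a S'" "a \<notin> S'" "S' \<subseteq> A" "finite S'"
      using True insert.prems finS by (auto simp: S'_def)
    interpret S': prob_space "Pi\<^sub>M S' (\<lambda>_. std_exp)"
      by (intro prob_space_PiM prob_space_std_exp)
    have [measurable]: "(\<lambda>y. \<integral>\<^sup>+z. F (D y + (\<Sum>j\<in>S'. D (t + z j))) \<partial>Pi\<^sub>M S' (\<lambda>_. std_exp)) \<in> borel_measurable borel"
      by (rule S'.borel_measurable_nn_integral) measurable
    have "(\<integral>\<^sup>+x. (\<Prod>j\<in>insert a A. ?I S j (x j)) * F (\<Sum>j\<in>S. D (x j)) \<partial>Pi\<^sub>M (insert a A) (\<lambda>_. std_exp))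
        = (\<integral>\<^sup>+y. (\<integral>\<^sup>+x. (\<Prod>j\<in>insert a A. ?I S j ((x(a := y)) j)) * F (\<Sum>j\<in>S. D ((x(a := y)) j))
             \<partial>Pi\<^sub>M A (\<lambda>_. std_exp)) \<partial>std_exp)"
      using insert.hyps meas by (rule product_nn_integral_insert_rev)
    also have "\<dots> = (\<integral>\<^sup>+y. indicator {t<..} y * (\<integral>\<^sup>+x. (\<Prod>j\<in>A. ?I S' j (x j)) * F (D y + (\<Sum>j\<in>S'. D (x j)))
             \<partial>Pi\<^sub>M A (\<lambda>_. std_exp)) \<partial>std_exp)"
    proof (intro nn_integral_cong)
      fix y
      have "(\<integral>\<^sup>+x. (\<Prod>j\<in>insert a A. ?I S j ((x(a := y)) j)) * F (\<Sum>j\<in>S. D ((x(a := y)) j)) \<partial>Pi\<^sub>M A (\<lambda>_. std_exp))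
          = (\<integral>\<^sup>+x. indicator {t<..} y * ((\<Prod>j\<in>A. ?I S' j (x j)) * F (D y + (\<Sum>j\<in>S'. D (x j)))) \<partial>Pi\<^sub>M A (\<lambda>_. std_exp))"
        using insert.hyps True S'(1,2,4) upd sum_upd
        by (intro nn_integral_cong) (simp add: S'_def[symmetric] sum.insert mult.assoc)
      also have "\<dots> = indicator {t<..} y * (\<integral>\<^sup>+x. ((\<Prod>j\<in>A. ?I S' j (x j)) * F (D y + (\<Sum>j\<in>S'. D (x j)))) \<partial>Pi\<^sub>M A (\<lambda>_. std_exp))"
        using sumD[OF S'(3)] by (intro nn_integral_cmult) (auto intro!: borel_measurable_times_ennreal borel_measurable_prod_ennreal
            measurable_compose[OF _ insert.prems(2)])
      finally show "(\<integral>\<^sup>+x. (\<Prod>j\<in>insert a A. ?I S j ((x(a := y)) j)) * F (\<Sum>j\<in>S. D ((x(a := y)) j)) \<partial>Pi\<^sub>M A (\<lambda>_. std_exp))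
          = indicator {t<..} y * (\<integral>\<^sup>+x. (\<Prod>j\<in>A. ?I S' j (x j)) * F (D y + (\<Sum>j\<in>S'. D (x j))) \<partial>Pi\<^sub>M A (\<lambda>_. std_exp))"
        by simp
    qed
    also have "\<dots> = (\<integral>\<^sup>+y. indicator {t<..} y * (ennreal (exp (- t)) ^ card S' * ennreal (1 - exp (- t)) ^ card (A - S')
         * (\<integral>\<^sup>+z. F (D y + (\<Sum>j\<in>S'. D (t + z j))) \<partial>Pi\<^sub>M S' (\<lambda>_. std_exp))) \<partial>std_exp)"
      by (subst insert.IH[OF S'(3), of "\<lambda>w. F (D _ + w)"]) simp_all
    also have "\<dots> = ennreal (exp (- t)) * (\<integral>\<^sup>+y. ennreal (exp (- t)) ^ card S' * ennreal (1 - exp (- t)) ^ card (A - S')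
         * (\<integral>\<^sup>+z. F (D (t + y) + (\<Sum>j\<in>S'. D (t + z j))) \<partial>Pi\<^sub>M S' (\<lambda>_. std_exp)) \<partial>std_exp)"
      using assms(3) by (subst nn_integral_std_exp_shift) simp_all
    also have "\<dots> = ennreal (exp (- t)) * (ennreal (exp (- t)) ^ card S' * ennreal (1 - exp (- t)) ^ card (A - S'))
         * (\<integral>\<^sup>+y. (\<integral>\<^sup>+z. F (D (t + y) + (\<Sum>j\<in>S'. D (t + z j))) \<partial>Pi\<^sub>M S' (\<lambda>_. std_exp)) \<partial>std_exp)"
      by (subst nn_integral_cmult) (simp_all add: mult.assoc)
    \<comment> \<open>The excess of \<open>a\<close> rejoins those of the other coordinates of
      \<open>S\<close> in one product integral.\<close>
    also have "(\<integral>\<^sup>+y. (\<integral>\<^sup>+z. F (D (t + y) + (\<Sum>j\<in>S'. D (t + z j))) \<partial>Pi\<^sub>M S' (\<lambda>_. std_exp)) \<partial>std_exp)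
        = (\<integral>\<^sup>+z. F (\<Sum>j\<in>S. D (t + z j)) \<partial>Pi\<^sub>M S (\<lambda>_. std_exp))"
    proof -
      have "(\<Sum>j\<in>S'. D (t + (if j = a then y else z j))) = (\<Sum>j\<in>S'. D (t + z j))" for y z
        using S'(2) by (intro sum.cong) auto
      then show ?thesis
        unfolding S'(1) using S'(2,4)
        by (subst product_nn_integral_insert_rev) simp_all
    qed
    also have "ennreal (exp (- t)) * (ennreal (exp (- t)) ^ card S' * ennreal (1 - exp (- t)) ^ card (A - S'))
        = ennreal (exp (- t)) ^ card S * ennreal (1 - exp (- t)) ^ card (insert a A - S)"
    proof -
      have "insert a A - S = A - S'" "card S = Suc (card S')"
        using S' insert.hyps(2) by auto
      then show ?thesis by (simp add: mult.assoc)
    qed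
    finally show ?thesis .
  next
    case False
    have SA: "S \<subseteq> A" and S_eq: "S - {a} = S"
      using False insert.prems(1) by auto
    have "(\<integral>\<^sup>+x. (\<Prod>j\<in>insert a A. ?I S j (x j)) * F (\<Sum>j\<in>S. D (x j)) \<partial>Pi\<^sub>M (insert a A) (\<lambda>_. std_exp))
        = (\<integral>\<^sup>+y. (\<integral>\<^sup>+x. (\<Prod>j\<in>insert a A. ?I S j ((x(a := y)) j)) * F (\<Sum>j\<in>S. D ((x(a := y)) j))
             \<partial>Pi\<^sub>M A (\<lambda>_. std_exp)) \<partial>std_exp)"
      using insert.hyps meas by (rule product_nn_integral_insert_rev)
    also have "\<dots> = (\<integral>\<^sup>+y. indicator {..<t} y * (\<integral>\<^sup>+x. (\<Prod>j\<in>A. ?I S j (x j)) * F (\<Sum>j\<in>S. D (x j))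
             \<partial>Pi\<^sub>M A (\<lambda>_. std_exp)) \<partial>std_exp)"
    proof (intro nn_integral_cong)
      fix y
      have "(\<integral>\<^sup>+x. (\<Prod>j\<in>insert a A. ?I S j ((x(a := y)) j)) * F (\<Sum>j\<in>S. D ((x(a := y)) j)) \<partial>Pi\<^sub>M A (\<lambda>_. std_exp))
          = (\<integral>\<^sup>+x. indicator {..<t} y * ((\<Prod>j\<in>A. ?I S j (x j)) * F (\<Sum>j\<in>S. D (x j))) \<partial>Pi\<^sub>M A (\<lambda>_. std_exp))"
        using insert.hyps False upd sum_upd S_eq
        by (intro nn_integral_cong) (simp add: mult.assoc)
      also have "\<dots> = indicator {..<t} y * (\<integral>\<^sup>+x. ((\<Prod>j\<in>A. ?I S j (x j)) * F (\<Sum>j\<in>S. D (x j))) \<partial>Pi\<^sub>M A (\<lambda>_. std_exp))"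
        using sumD[OF SA] by (intro nn_integral_cmult) (auto intro!: borel_measurable_times_ennreal borel_measurable_prod_ennreal
            measurable_compose[OF _ insert.prems(2)])
      finally show "(\<integral>\<^sup>+x. (\<Prod>j\<in>insert a A. ?I S j ((x(a := y)) j)) * F (\<Sum>j\<in>S. D ((x(a := y)) j)) \<partial>Pi\<^sub>M A (\<lambda>_. std_exp))
          = indicator {..<t} y * (\<integral>\<^sup>+x. (\<Prod>j\<in>A. ?I S j (x j)) * F (\<Sum>j\<in>S. D (x j)) \<partial>Pi\<^sub>M A (\<lambda>_. std_exp))"
        by simp
    qed
    also have "\<dots> = ennreal (1 - exp (- t)) * (ennreal (exp (- t)) ^ card S * ennreal (1 - exp (- t)) ^ card (A - S)
         * (\<integral>\<^sup>+z. F (\<Sum>j\<in>S. D (t + z j)) \<partial>Pi\<^sub>M S (\<lambda>_. std_exp)))"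
      using assms(3) by (simp add: nn_integral_std_exp_lessThan insert.IH[OF SA insert.prems(2)])
    also have "insert a A - S = insert a (A - S)"
      using False by auto
    then have "ennreal (1 - exp (- t)) ^ card (insert a A - S) = ennreal (1 - exp (- t)) * ennreal (1 - exp (- t)) ^ card (A - S)"
      using insert.hyps by simp
    then have "ennreal (1 - exp (- t)) * (ennreal (exp (- t)) ^ card S * ennreal (1 - exp (- t)) ^ card (A - S)
         * (\<integral>\<^sup>+z. F (\<Sum>j\<in>S. D (t + z j)) \<partial>Pi\<^sub>M S (\<lambda>_. std_exp)))
      = ennreal (exp (- t)) ^ card S * ennreal (1 - exp (- t)) ^ card (insert a A - S)
         * (\<integral>\<^sup>+z. F (\<Sum>j\<in>S. D (t + z j)) \<partial>Pi\<^sub>M S (\<lambda>_. std_exp))"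
      by (simp add: mult_ac)
    finally show ?thesis .
  qed
qed

text \<open>A tie between \<open>i\<close> and \<open>j\<close> forces coordinate \<open>i\<close>
  to hit the single point \<open>x j\<close> once the others are fixed, which has probability 0 for
  an atomless law.\<close>

lemma AE_PiM_std_exp_inj:
  "AE x in Pi\<^sub>M {..<n::nat} (\<lambda>_. std_exp). inj_on x {..<n}"
proof -
  interpret product_prob_space "\<lambda>_. std_exp" UNIV
    by (intro product_prob_spaceI prob_space_std_exp)
  have ne: "AE x in Pi\<^sub>M {..<n} (\<lambda>_. std_exp). x i \<noteq> x j" if ij: "i < n" "j < n" "i \<noteq> j" for i j
  proof -
    have I: "{..<n} = insert i ({..<n} - {i})"
      using ij by auto
    have [measurable]: "(\<lambda>x. x i) \<in> borel_measurable (Pi\<^sub>M {..<n} (\<lambda>_. std_exp))"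
      "(\<lambda>x. x j) \<in> borel_measurable (Pi\<^sub>M {..<n} (\<lambda>_. std_exp))"
      using ij by auto
    have "(\<integral>\<^sup>+x. indicator {0} (x i - x j) \<partial>Pi\<^sub>M {..<n} (\<lambda>_. std_exp))
        = (\<integral>\<^sup>+x. (\<integral>\<^sup>+y. indicator {0} ((x(i := y)) i - (x(i := y)) j) \<partial>std_exp) \<partial>Pi\<^sub>M ({..<n} - {i}) (\<lambda>_. std_exp))"
      using product_nn_integral_insert[of "{..<n} - {i}" i "\<lambda>x. indicator {0} (x i - x j)", folded I]
      by simp
    also have "\<dots> = (\<integral>\<^sup>+x. (\<integral>\<^sup>+y. indicator {x j} y \<partial>std_exp) \<partial>Pi\<^sub>M ({..<n} - {i}) (\<lambda>_. std_exp))"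
      using ij by (intro nn_integral_cong) (auto simp: indicator_def)
    also have "\<dots> = 0"
      by (simp add: emeasure_std_exp_singleton)
    finally have "AE x in Pi\<^sub>M {..<n} (\<lambda>_. std_exp). indicator {0} (x i - x j) = (0::ennreal)"
      by (subst (asm) nn_integral_0_iff_AE) simp_all
    then show ?thesis
      by eventually_elim (auto simp: indicator_def split: if_splits)
  qed
  have "AE x in Pi\<^sub>M {..<n} (\<lambda>_. std_exp). \<forall>i\<in>{..<n}. \<forall>j\<in>{..<n} - {i}. x i \<noteq> x j"
    using ne by (intro AE_finite_allI) auto
  then show ?thesis
    by eventually_elim (auto simp: inj_on_def)
qed

text \<open>The density of the (k+1)th largest of \<open>n\<close> standard exponentials. The
  constant is the classical n! / (k! (n - k - 1)!), kept as a number of configurations: it is never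
  evaluated, since the normalisation follows from the probabilistic meaning.\<close>

definition order_density :: "nat \<Rightarrow> nat \<Rightarrow> real \<Rightarrow> real" where
  "order_density n k t =
     (if 0 < t then real (card (splits n k)) * exp (- (real k + 1) * t) * (1 - exp (- t)) ^ (n - k - 1) else 0)"

lemma order_density_nonneg: "0 \<le> order_density n k t"
  by (simp add: order_density_def)

lemma measurable_order_density [measurable]: "order_density n k \<in> borel_measurable borel"
  unfolding order_density_def by measurable

lemma order_density_cond:
  assumes "0 < t"
  shows "ennreal (order_density n k t)
      = of_nat (card (splits n k)) * (ennreal (exp (- t)) * (ennreal (exp (- t)) ^ k * ennreal (1 - exp (- t)) ^ (n - k - 1)))"
proof -
  have "order_density n k t = real (card (splits n k)) * (exp (- t) * (exp (- t) ^ k * (1 - exp (- t)) ^ (n - k - 1)))"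
    using assms by (simp add: order_density_def algebra_simps exp_add exp_diff exp_minus exp_of_nat2_mult power_inverse divide_inverse)
  also have "ennreal \<dots> = ennreal (real (card (splits n k))) * (ennreal (exp (- t)) * (ennreal (exp (- t) ^ k) * ennreal ((1 - exp (- t)) ^ (n - k - 1))))"
    using assms by (simp add: ennreal_mult)
  finally show ?thesis
    using assms by (simp add: ennreal_power ennreal_of_nat_eq_real_of_nat)
qed

text \<open>Renyi's representation in weak form: given \<open>Y\<^sub>(\<^sub>k\<^sub>+\<^sub>1\<^sub>) = t\<close>, the exceedances of the
  \<open>k\<close> largest observations over \<open>t\<close> are, up to order, independent standard exponentials.\<close>

lemma nn_integral_order_stats:
  fixes f :: "real \<Rightarrow> real \<Rightarrow> ennreal" and d :: "real \<Rightarrow> real \<Rightarrow> real"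
  assumes "k < n"
    and f [measurable]: "case_prod f \<in> borel_measurable (borel \<Otimes>\<^sub>M borel)"
    and d [measurable]: "case_prod d \<in> borel_measurable (borel \<Otimes>\<^sub>M borel)"
    and [measurable]: "\<phi> \<in> borel_measurable borel"
    and \<phi>: "\<And>(S :: nat set) t. finite S \<Longrightarrow> card S = k \<Longrightarrow> 0 < t \<Longrightarrow>
      (\<integral>\<^sup>+z. f t (\<Sum>j\<in>S. d t (t + z j)) \<partial>Pi\<^sub>M S (\<lambda>_. std_exp)) = \<phi> t"
  shows "(\<integral>\<^sup>+x. f (order_stat n (\<lambda>i x. x i) (k + 1) x)
              (\<Sum>l=1..k. d (order_stat n (\<lambda>i x. x i) (k + 1) x) (order_stat n (\<lambda>i x. x i) l x))
            \<partial>Pi\<^sub>M {..<n} (\<lambda>_. std_exp))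
       = (\<integral>\<^sup>+t. ennreal (order_density n k t) * \<phi> t \<partial>lborel)"
proof -
  interpret product_prob_space "\<lambda>_. std_exp" UNIV
    by (intro product_prob_spaceI prob_space_std_exp)
  \<comment> \<open>\<open>h (i, S)\<close> is the integrand cut down to the event that
    \<open>(i, S)\<close> splits the sample. The event is written as a product over the coordinates
    other than \<open>i\<close>, the form that \<open>nn_integral_PiM_memoryless\<close>
    integrates.\<close>
  define h where "h = (\<lambda>(i, S) x. (\<Prod>j\<in>{..<n} - {i}. indicator (if j \<in> S then {x i<..} else {..<x i}) (x j :: real))
      * f (x i) (\<Sum>j\<in>S. d (x i) (x j)))"
  let ?T = "\<lambda>l x. order_stat n (\<lambda>i x. x i) l (x :: nat \<Rightarrow> real)"
  have h_eq: "h p x = (if splits_at n x p then f (?T (k + 1) x) (\<Sum>l=1..k. d (?T (k + 1) x) (?T l x)) else 0)"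
    if "p \<in> splits n k" for p x
  proof -
    obtain i S where [simp]: "p = (i, S)" by (cases p)
    have iS: "i < n" "S \<subseteq> {..<n} - {i}" "card S = k"
      using that by (auto simp: splits_def)
    show ?thesis
    proof (cases "splits_at n x p")
      case True
      then have ab: "\<And>j. j \<in> S \<Longrightarrow> x i < x j" "\<And>j. j \<in> {..<n} - {i} - S \<Longrightarrow> x j < x i"
        by (auto simp: splits_at_def)
      have "(\<Prod>j\<in>{..<n} - {i}. indicator (if j \<in> S then {x i<..} else {..<x i}) (x j)) = (1::ennreal)"
        using ab by (intro prod.neutral) auto
      then show ?thesis
        using True order_stat_split(1)[OF iS, of "\<lambda>i x. x i" x]
          order_stat_split(2)[OF iS, of "\<lambda>i x. x i" x "d (x i)"] ab by (simp add: h_def)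
    next
      case False
      have "\<exists>j\<in>{..<n} - {i}. \<not> (if j \<in> S then x i < x j else x j < x i)"
      proof (rule ccontr)
        assume "\<not> ?thesis"
        then have all: "if j \<in> S then x i < x j else x j < x i" if "j \<in> {..<n} - {i}" for j
          using that by blast
        have "x i < x j" if "j \<in> S" for j
          using all[of j] that iS(2) by auto
        moreover have "x j < x i" if "j \<in> {..<n} - {i} - S" for j
          using all[of j] that by auto
        ultimately have "splits_at n x p"
          by (simp add: splits_at_def)
        then show False using False by contradiction
      qed
      then obtain j where "j \<in> {..<n} - {i}" "\<not> (if j \<in> S then x i < x j else x j < x i)"
        by blast
      then have "(\<Prod>j\<in>{..<n} - {i}. indicator (if j \<in> S then {x i<..} else {..<x i}) (x j)) = (0::ennreal)"
        by (intro prod_zero) (auto intro!: bexI[of _ j])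
      then show ?thesis
        using False by (simp add: h_def)
    qed
  qed
  have meas: "h p \<in> borel_measurable (Pi\<^sub>M {..<n} (\<lambda>_. std_exp))" if "p \<in> splits n k" for p
  proof -
    obtain i S where [simp]: "p = (i, S)" by (cases p)
    have iS: "i < n" "S \<subseteq> {..<n} - {i}"
      using that by (auto simp: splits_def)
    have [measurable]: "(\<lambda>x. x j) \<in> borel_measurable (Pi\<^sub>M {..<n} (\<lambda>_. std_exp))" if "j < n" for j
      using that by simp
    have "(\<lambda>x. indicator (if j \<in> S then {x i<..} else {..<x i}) (x j) :: ennreal) \<in> borel_measurable (Pi\<^sub>M {..<n} (\<lambda>_. std_exp))"
      if "j < n" for j
    proof -
      \<comment> \<open>A fixed half-line evaluated at a difference replaces the half-line that
        moves with \<open>x i\<close>, which makes measurability immediate.\<close>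
      have "(\<lambda>x. indicator (if j \<in> S then {x i<..} else {..<x i}) (x j :: real) :: ennreal)
          = (\<lambda>x. if j \<in> S then indicator {0<..} (x j - x i) else indicator {..<0} (x j - x i))"
        by (auto simp: fun_eq_iff indicator_def)
      then show ?thesis using that iS by simp
    qed
    moreover have "(\<lambda>x. \<Sum>j\<in>S. d (x i) (x j)) \<in> borel_measurable (Pi\<^sub>M {..<n} (\<lambda>_. std_exp))"
    proof (rule borel_measurable_sum)
      fix j assume "j \<in> S"
      then have "j < n" using iS by auto
      then show "(\<lambda>x. d (x i) (x j)) \<in> borel_measurable (Pi\<^sub>M {..<n} (\<lambda>_. std_exp))"
        using iS by measurable
    qed
    then have "(\<lambda>x. f (x i) (\<Sum>j\<in>S. d (x i) (x j))) \<in> borel_measurable (Pi\<^sub>M {..<n} (\<lambda>_. std_exp))"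
      using iS by measurable
    ultimately show ?thesis
      unfolding h_def by (auto intro!: borel_measurable_times_ennreal borel_measurable_prod_ennreal)
  qed
  have integral_h: "(\<integral>\<^sup>+x. h p x \<partial>Pi\<^sub>M {..<n} (\<lambda>_. std_exp))
    = (\<integral>\<^sup>+t. ennreal (exp (- t)) * (ennreal (exp (- t)) ^ k * ennreal (1 - exp (- t)) ^ (n - k - 1)) * indicator {0<..} t * \<phi> t \<partial>lborel)"
    if p: "p \<in> splits n k" for p
  proof -
    obtain i S where [simp]: "p = (i, S)" by (cases p)
    have iS: "i < n" "S \<subseteq> {..<n} - {i}" "card S = k" "finite S"
      using p finite_subset by (auto simp: splits_def)
    have I: "insert i ({..<n} - {i}) = {..<n}"
      using iS by auto
    have card: "card ({..<n} - {i} - S) = n - k - 1"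
      using iS by (simp add: card_Diff_subset)
    \<comment> \<open>Coordinate \<open>i\<close> is integrated last: its value \<open>t\<close> is
      the threshold that separates \<open>S\<close> from the remaining observations.\<close>
    have "(\<integral>\<^sup>+x. h p x \<partial>Pi\<^sub>M {..<n} (\<lambda>_. std_exp))
        = (\<integral>\<^sup>+t. (\<integral>\<^sup>+x. h p (x(i := t)) \<partial>Pi\<^sub>M ({..<n} - {i}) (\<lambda>_. std_exp)) \<partial>std_exp)"
      using product_nn_integral_insert_rev[of "{..<n} - {i}" i "h p"] meas[OF p] by (simp add: I del: insert_Diff_single)
    also have "\<dots> = (\<integral>\<^sup>+t. ennreal (exp (- t)) ^ k * ennreal (1 - exp (- t)) ^ (n - k - 1) * \<phi> t \<partial>std_exp)"
    proof (rule nn_integral_cong_AE)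
      show "AE t in std_exp. (\<integral>\<^sup>+x. h p (x(i := t)) \<partial>Pi\<^sub>M ({..<n} - {i}) (\<lambda>_. std_exp))
          = ennreal (exp (- t)) ^ k * ennreal (1 - exp (- t)) ^ (n - k - 1) * \<phi> t"
        using AE_std_exp_pos
      proof eventually_elim
        case (elim t)
        have "(\<Sum>j\<in>S. d t ((x(i := t)) j)) = (\<Sum>j\<in>S. d t (x j))" for x
          using iS by (intro sum.cong) auto
        moreover have "(\<Prod>j\<in>{..<n} - {i}. indicator (if j \<in> S then {t<..} else {..<t}) ((x(i := t)) j))
            = (\<Prod>j\<in>{..<n} - {i}. indicator (if j \<in> S then {t<..} else {..<t}) (x j) :: ennreal)" for x
          by (intro prod.cong) auto
        ultimately have "(\<integral>\<^sup>+x. h p (x(i := t)) \<partial>Pi\<^sub>M ({..<n} - {i}) (\<lambda>_. std_exp))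
            = (\<integral>\<^sup>+x. (\<Prod>j\<in>{..<n} - {i}. indicator (if j \<in> S then {t<..} else {..<t}) (x j)) * f t (\<Sum>j\<in>S. d t (x j))
              \<partial>Pi\<^sub>M ({..<n} - {i}) (\<lambda>_. std_exp))"
          by (simp add: h_def cong: if_cong)
        also have "\<dots> = ennreal (exp (- t)) ^ k * ennreal (1 - exp (- t)) ^ (n - k - 1) * \<phi> t"
          using elim iS card by (subst nn_integral_PiM_memoryless) (simp_all add: \<phi>)
        finally show ?case .
      qed
    qed
    also have "\<dots> = (\<integral>\<^sup>+t. ennreal (exp (- t)) * (ennreal (exp (- t)) ^ k * ennreal (1 - exp (- t)) ^ (n - k - 1)) * indicator {0<..} t * \<phi> t \<partial>lborel)"
      by (subst nn_integral_std_exp) (simp_all add: mult_ac)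
    finally show ?thesis .
  qed
  have "(\<integral>\<^sup>+x. f (?T (k + 1) x) (\<Sum>l=1..k. d (?T (k + 1) x) (?T l x)) \<partial>Pi\<^sub>M {..<n} (\<lambda>_. std_exp))
      = (\<integral>\<^sup>+x. (\<Sum>p\<in>splits n k. h p x) \<partial>Pi\<^sub>M {..<n} (\<lambda>_. std_exp))"
  proof (rule nn_integral_cong_AE)
    show "AE x in Pi\<^sub>M {..<n} (\<lambda>_. std_exp). f (?T (k + 1) x) (\<Sum>l=1..k. d (?T (k + 1) x) (?T l x)) = (\<Sum>p\<in>splits n k. h p x)"
      using AE_PiM_std_exp_inj
    proof eventually_elim
      case (elim x)
      \<comment> \<open>Ties have probability 0, and without ties a single pair splits the sample,
        so only one term of the sum can be nonzero.\<close>
      obtain p where p: "p \<in> splits n k" "splits_at n x p"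
        and uniq: "\<And>q. q \<in> splits n k \<Longrightarrow> splits_at n x q \<Longrightarrow> q = p"
        using ex1_splits_at[OF elim \<open>k < n\<close>] by metis
      have "h q x = 0" if "q \<in> splits n k" "q \<noteq> p" for q
        using uniq[of q] that h_eq[of q x] by auto
      then have "(\<Sum>q\<in>splits n k. h q x) = (\<Sum>q\<in>splits n k. if q = p then h p x else 0)"
        by (intro sum.cong) auto
      also have "\<dots> = h p x"
        using p(1) finite_splits by simp
      finally show ?case using p by (simp add: h_eq)
    qed
  qed
  also have "\<dots> = (\<Sum>p\<in>splits n k. \<integral>\<^sup>+x. h p x \<partial>Pi\<^sub>M {..<n} (\<lambda>_. std_exp))"
    using meas by (rule nn_integral_sum)
  also have "\<dots> = of_nat (card (splits n k)) *
      (\<integral>\<^sup>+t. ennreal (exp (- t)) * (ennreal (exp (- t)) ^ k * ennreal (1 - exp (- t)) ^ (n - k - 1)) * indicator {0<..} t * \<phi> t \<partial>lborel)"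
    by (simp add: integral_h)
  also have "\<dots> = (\<integral>\<^sup>+t. of_nat (card (splits n k)) * (ennreal (exp (- t)) * (ennreal (exp (- t)) ^ k * ennreal (1 - exp (- t)) ^ (n - k - 1)) * indicator {0<..} t * \<phi> t) \<partial>lborel)"
    by (subst nn_integral_cmult) simp_all
  also have "\<dots> = (\<integral>\<^sup>+t. ennreal (order_density n k t) * \<phi> t \<partial>lborel)"
  proof (intro nn_integral_cong)
    fix t :: real
    show "of_nat (card (splits n k)) * (ennreal (exp (- t)) * (ennreal (exp (- t)) ^ k * ennreal (1 - exp (- t)) ^ (n - k - 1)) * indicator {0<..} t * \<phi> t)
        = ennreal (order_density n k t) * \<phi> t"
      by (cases "0 < t") (simp_all add: order_density_cond mult_ac, simp add: order_density_def)
  qed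
  finally show ?thesis .
qed

section \<open>Moments of sums of independent copies\<close>

text \<open>On the product space the coordinates together form the identity map, so their joint law
  is the product measure itself, which characterises independence.\<close>

lemma indep_vars_PiM_coordinates:
  assumes "\<And>i. i \<in> I \<Longrightarrow> prob_space (M i)" "I \<noteq> {}"
  shows "prob_space.indep_vars (Pi\<^sub>M I M) M (\<lambda>i x. x i) I"
proof -
  interpret prob_space "Pi\<^sub>M I M"
    using assms(1) by (rule prob_space_PiM)
  have "distr (Pi\<^sub>M I M) (Pi\<^sub>M I M) (\<lambda>x. \<lambda>i\<in>I. x i) = distr (Pi\<^sub>M I M) (Pi\<^sub>M I M) (\<lambda>x. x)"
    by (rule distr_cong) (auto simp: space_PiM PiE_restrict)
  also have "\<dots> = Pi\<^sub>M I M"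
    by (simp add: distr_id)
  also have "\<dots> = (\<Pi>\<^sub>M i\<in>I. distr (Pi\<^sub>M I M) (M i) (\<lambda>x. x i))"
    using distr_PiM_component[of I M] assms(1) by (intro PiM_cong) auto
  finally show ?thesis
    using assms(2) by (subst indep_vars_iff_distr_eq_PiM') auto
qed

text \<open>The square is expanded into a double sum. By independence the off-diagonal terms have
  mean equal to the squared mean of \<open>g\<close>, and the diagonal terms give its second
  moment.\<close>

lemma
  fixes g :: "'b \<Rightarrow> real"
  assumes "prob_space M" "finite S"
    and [measurable]: "g \<in> borel_measurable M"
    and sq: "integrable M (\<lambda>z. (g z)\<^sup>2)"
  shows integrable_PiM_sum: "integrable (Pi\<^sub>M S (\<lambda>_. M)) (\<lambda>x. \<Sum>j\<in>S. g (x j))"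
    and integrable_PiM_sum_square: "integrable (Pi\<^sub>M S (\<lambda>_. M)) (\<lambda>x. (\<Sum>j\<in>S. g (x j))\<^sup>2)"
    and integral_PiM_sum: "(\<integral>x. (\<Sum>j\<in>S. g (x j)) \<partial>Pi\<^sub>M S (\<lambda>_. M)) = real (card S) * (\<integral>z. g z \<partial>M)"
    and integral_PiM_sum_square: "(\<integral>x. (\<Sum>j\<in>S. g (x j))\<^sup>2 \<partial>Pi\<^sub>M S (\<lambda>_. M))
      = real (card S) * prob_space.variance M g + (real (card S) * (\<integral>z. g z \<partial>M))\<^sup>2"
proof -
  interpret M: prob_space M by fact
  interpret P: prob_space "Pi\<^sub>M S (\<lambda>_. M)"
    by (intro prob_space_PiM assms(1))
  define a where "a = (\<integral>z. g z \<partial>M)"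
  have g: "integrable M g"
    using sq by (rule M.square_integrable_imp_integrable[rotated]) simp
  have comp: "distr (Pi\<^sub>M S (\<lambda>_. M)) M (\<lambda>x. x j) = M" if "j \<in> S" for j
    using distr_PiM_component[of S "\<lambda>_. M" j] assms(1) that by simp
  have [measurable]: "(\<lambda>x. x j) \<in> Pi\<^sub>M S (\<lambda>_. M) \<rightarrow>\<^sub>M M" if "j \<in> S" for j
    using that by simp
  have int1: "integrable (Pi\<^sub>M S (\<lambda>_. M)) (\<lambda>x. f (x j))" "(\<integral>x. f (x j) \<partial>Pi\<^sub>M S (\<lambda>_. M)) = (\<integral>z. f z \<partial>M)"
    if "j \<in> S" "integrable M f" for j and f :: "'b \<Rightarrow> real"
  proof -
    have [measurable]: "f \<in> borel_measurable M" using that(2) by simp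
    show "integrable (Pi\<^sub>M S (\<lambda>_. M)) (\<lambda>x. f (x j))"
      using that comp[OF that(1)] integrable_distr_eq[of "\<lambda>x. x j" "Pi\<^sub>M S (\<lambda>_. M)" M f] by simp
    show "(\<integral>x. f (x j) \<partial>Pi\<^sub>M S (\<lambda>_. M)) = (\<integral>z. f z \<partial>M)"
      using that comp[OF that(1)] integral_distr[of "\<lambda>x. x j" "Pi\<^sub>M S (\<lambda>_. M)" M f] by simp
  qed
  have int2: "integrable (Pi\<^sub>M S (\<lambda>_. M)) (\<lambda>x. g (x i) * g (x j)) \<and>
      (\<integral>x. g (x i) * g (x j) \<partial>Pi\<^sub>M S (\<lambda>_. M)) = (if i = j then (\<integral>z. (g z)\<^sup>2 \<partial>M) else a\<^sup>2)"
    if ij: "i \<in> S" "j \<in> S" for i j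
  proof (cases "i = j")
    case True
    then show ?thesis using int1[OF ij(1) sq] by (simp add: power2_eq_square)
  next
    case False
    have "P.indep_vars (\<lambda>_. M) (\<lambda>i x. x i) S"
      using ij by (intro indep_vars_PiM_coordinates assms(1)) auto
    then have "P.indep_vars (\<lambda>_. borel) (\<lambda>i x. g (x i)) S"
      by (rule P.indep_vars_compose2) simp
    then have "P.indep_vars (\<lambda>_. borel) (\<lambda>i x. g (x i)) {i, j}"
      by (rule P.indep_vars_subset) (use ij in auto)
    then have *: "integrable (Pi\<^sub>M S (\<lambda>_. M)) (\<lambda>x. \<Prod>l\<in>{i, j}. g (x l))"
      "(\<integral>x. (\<Prod>l\<in>{i, j}. g (x l)) \<partial>Pi\<^sub>M S (\<lambda>_. M)) = (\<Prod>l\<in>{i, j}. \<integral>x. g (x l) \<partial>Pi\<^sub>M S (\<lambda>_. M))"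
      using ij int1(1)[OF _ g] by (auto intro!: P.indep_vars_integrable P.indep_vars_lebesgue_integral)
    then show ?thesis
      using False ij int1(2)[OF _ g] by (simp add: a_def power2_eq_square)
  qed
  show "integrable (Pi\<^sub>M S (\<lambda>_. M)) (\<lambda>x. \<Sum>j\<in>S. g (x j))"
    using int1[OF _ g] by (intro Bochner_Integration.integrable_sum)
  show "(\<integral>x. (\<Sum>j\<in>S. g (x j)) \<partial>Pi\<^sub>M S (\<lambda>_. M)) = real (card S) * (\<integral>z. g z \<partial>M)"
    using int1[OF _ g] by (subst Bochner_Integration.integral_sum) simp_all
  have expand: "(\<lambda>x. (\<Sum>j\<in>S. g (x j))\<^sup>2) = (\<lambda>x. \<Sum>i\<in>S. \<Sum>j\<in>S. g (x i) * g (x j))"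
    by (simp add: power2_eq_square sum_product)
  show "integrable (Pi\<^sub>M S (\<lambda>_. M)) (\<lambda>x. (\<Sum>j\<in>S. g (x j))\<^sup>2)"
    unfolding expand using int2 by (intro Bochner_Integration.integrable_sum) blast
  have "(\<integral>x. (\<Sum>j\<in>S. g (x j))\<^sup>2 \<partial>Pi\<^sub>M S (\<lambda>_. M))
      = (\<Sum>i\<in>S. \<Sum>j\<in>S. if i = j then (\<integral>z. (g z)\<^sup>2 \<partial>M) else a\<^sup>2)"
    unfolding expand using int2
    by (simp add: Bochner_Integration.integral_sum Bochner_Integration.integrable_sum)
  \<comment> \<open>Splitting the variance off the diagonal leaves the same constant in every
    entry.\<close>
  also have "\<dots> = (\<Sum>i\<in>S. \<Sum>j\<in>S. (if i = j then (\<integral>z. (g z)\<^sup>2 \<partial>M) - a\<^sup>2 else 0) + a\<^sup>2)"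
    by (intro sum.cong) auto
  also have "\<dots> = real (card S) * ((\<integral>z. (g z)\<^sup>2 \<partial>M) - a\<^sup>2) + (real (card S) * a)\<^sup>2"
    using assms(2) by (simp add: sum.distrib power2_eq_square algebra_simps)
  also have "(\<integral>z. (g z)\<^sup>2 \<partial>M) - a\<^sup>2 = M.variance g"
    using g sq by (simp add: M.variance_eq a_def)
  finally show "(\<integral>x. (\<Sum>j\<in>S. g (x j))\<^sup>2 \<partial>Pi\<^sub>M S (\<lambda>_. M))
      = real (card S) * M.variance g + (real (card S) * (\<integral>z. g z \<partial>M))\<^sup>2"
    by (simp add: a_def)
qed

section \<open>Quantile transformation\<close>

text \<open>Right continuity of the distribution function makes the infimum a minimum, hence the
  quantile a Galois inverse. The assumption 1 < t puts the level 1 - 1 / t strictly between 0 and 1,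
  so that the set is nonempty and bounded below.\<close>

lemma tail_quantile_le_iff:
  assumes "real_distribution \<rho>" "1 < t"
  shows "tail_quantile (cdf \<rho>) t \<le> x \<longleftrightarrow> 1 - 1 / t \<le> cdf \<rho> x"
proof -
  interpret real_distribution \<rho> by fact
  define q where "q = 1 - 1 / t"
  define A where "A = {x. q \<le> cdf \<rho> x}"
  have q: "0 < q" "q < 1"
    using assms(2) by (auto simp: q_def)
  have "eventually (\<lambda>y. q < cdf \<rho> y) at_top"
    using cdf_lim_at_top_prob q(2) by (rule order_tendstoD)
  then have "A \<noteq> {}"
    by (auto simp: A_def eventually_at_top_linorder intro: less_imp_le)
  have "eventually (\<lambda>y. cdf \<rho> y < q) at_bot"
    using cdf_lim_at_bot q(1) by (rule order_tendstoD)
  then obtain m where m: "\<And>y. y \<le> m \<Longrightarrow> cdf \<rho> y < q"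
    by (auto simp: eventually_at_bot_linorder)
  then have bdd: "bdd_below A"
    by (intro bdd_belowI[of _ m]) (metis A_def linorder_not_le mem_Collect_eq nle_le)
  have "(cdf \<rho> \<longlongrightarrow> cdf \<rho> (Inf A)) (at_right (Inf A))"
    using cdf_is_right_cont by (simp add: continuous_within)
  moreover have "eventually (\<lambda>y. q \<le> cdf \<rho> y) (at_right (Inf A))"
    unfolding eventually_at_filter
  proof (rule always_eventually, intro allI impI)
    fix y assume "y \<in> {Inf A<..}"
    then obtain a where "a \<in> A" "a < y"
      using \<open>A \<noteq> {}\<close> by (metis cInf_lessD greaterThan_iff)
    then show "q \<le> cdf \<rho> y"
      using cdf_nondecreasing[of a y] by (simp add: A_def)
  qed
  ultimately have "q \<le> cdf \<rho> (Inf A)"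
    by (rule tendsto_lowerbound) simp
  then have "Inf A \<le> x \<longleftrightarrow> q \<le> cdf \<rho> x"
    using bdd cdf_nondecreasing[of "Inf A" x] cInf_lower[of x A] by (auto simp: A_def)
  then show ?thesis
    by (simp add: tail_quantile_def A_def q_def)
qed

lemma tail_quantile_mono:
  assumes "real_distribution \<rho>" "1 < s" "s \<le> t"
  shows "tail_quantile (cdf \<rho>) s \<le> tail_quantile (cdf \<rho>) t"
proof -
  have "1 - 1 / s \<le> 1 - 1 / t"
    using assms(2,3) by (simp add: frac_le)
  also have "\<dots> \<le> cdf \<rho> (tail_quantile (cdf \<rho>) t)"
    using assms by (subst tail_quantile_le_iff[symmetric]) auto
  finally show ?thesis
    using assms by (subst tail_quantile_le_iff) auto
qed

text \<open>Inverse transform sampling: for standard exponential z the level 1 - 1 / exp z = 1 -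
  exp(-z) is uniform on the unit interval. \<open>H\<close> is prescribed at positive arguments
  only, which carry all the mass.\<close>

lemma distr_tail_quantile_exp:
  assumes "real_distribution \<rho>"
    and [measurable]: "H \<in> borel_measurable borel"
    and H: "\<And>z. 0 < z \<Longrightarrow> H z = tail_quantile (cdf \<rho>) (exp z)"
  shows "distr std_exp borel H = \<rho>"
proof (rule cdf_unique)
  interpret E: prob_space std_exp by (rule prob_space_std_exp)
  interpret real_distribution \<rho> by fact
  show "real_distribution (distr std_exp borel H)"
    by (rule E.real_distribution_distr) simp
  show "real_distribution \<rho>" by fact
  show "cdf (distr std_exp borel H) = cdf \<rho>"
  proof
    fix x
    define q where "q = cdf \<rho> x"
    have q: "0 \<le> q" "q \<le> 1"
      by (simp_all add: q_def cdf_nonneg cdf_bounded_prob)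
    have "cdf (distr std_exp borel H) x = measure std_exp {z. H z \<le> x}"
      by (simp add: cdf_def2 measure_distr vimage_def)
    also have "\<dots> = measure std_exp {z. 1 - exp (- z) \<le> q}"
    proof (rule E.finite_measure_eq_AE)
      show "AE z in std_exp. z \<in> {z. H z \<le> x} \<longleftrightarrow> z \<in> {z. 1 - exp (- z) \<le> q}"
        using AE_std_exp_pos
        by eventually_elim
          (simp add: H tail_quantile_le_iff[OF assms(1)] q_def exp_minus divide_inverse)
    qed simp_all
    also have "\<dots> = q"
    \<comment> \<open>At level 1 the threshold - ln (1 - q) would be infinite.\<close>
    proof (cases "q = 1")
      case True
      then have "{z. 1 - exp (- z) \<le> q} = (UNIV :: real set)" by auto
      then show ?thesis using True E.prob_space by simp
    next
      case False
      then have "1 - exp (- z) \<le> q \<longleftrightarrow> z \<le> - ln (1 - q)" for z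
        using q ln_le_cancel_iff[of "1 - q" "exp (- z)"] by auto
      then have "{z. 1 - exp (- z) \<le> q} = {..- ln (1 - q)}"
        by auto
      moreover have "- ln (1 - q) \<ge> 0"
        using q False by simp
      ultimately show ?thesis
        using q False by (simp add: measure_def emeasure_erlang_density erlang_CDF_0)
    qed
    finally show "cdf (distr std_exp borel H) x = cdf \<rho> x"
      by (simp add: q_def)
  qed
qed

lemma distr_sample_PiM:
  fixes I :: "'i set"
  assumes "prob_space M" "I \<noteq> {}" "prob_space.indep_vars M (\<lambda>_. borel) X I"
    and "\<And>i. i \<in> I \<Longrightarrow> distr M borel (X i) = \<rho>"
  shows "distr M (\<Pi>\<^sub>M i\<in>I. borel) (\<lambda>\<omega>. \<lambda>i\<in>I. X i \<omega>) = (\<Pi>\<^sub>M i\<in>I. \<rho>)"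
proof -
  interpret prob_space M by fact
  have "distr M (\<Pi>\<^sub>M i\<in>I. borel) (\<lambda>\<omega>. \<lambda>i\<in>I. X i \<omega>) = (\<Pi>\<^sub>M i\<in>I. distr M borel (X i))"
    using assms(2,3) by (subst indep_vars_iff_distr_eq_PiM'[symmetric]) (auto simp: indep_vars_def)
  also have "\<dots> = (\<Pi>\<^sub>M i\<in>I. \<rho>)"
    using assms(4) by (rule PiM_cong[OF refl])
  finally show ?thesis .
qed

section \<open>The integrated von Mises function\<close>

lemma set_integrable_bounded_interval:
  fixes f :: "real \<Rightarrow> real"
  assumes [measurable]: "f \<in> borel_measurable borel" and "\<And>u. \<bar>f u\<bar> \<le> K"
  shows "set_integrable lborel {x<..y} f" "set_integrable lborel {x..y} f"
proof -
  have *: "set_integrable lborel A f" if "A \<in> sets borel" "A \<subseteq> {x..y}" for A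
  proof (rule set_integrable_bound[of _ _ "\<lambda>_. K"])
    have "set_integrable lborel {x..y} (\<lambda>_. K)"
      by (rule borel_integrable_atLeastAtMost') (rule continuous_on_const)
    then show "set_integrable lborel A (\<lambda>_. K)"
      by (rule set_integrable_subset) (use that in auto)
  qed (use that assms in \<open>auto simp: set_borel_measurable_def intro!: always_eventually order.trans[OF _ abs_ge_self]\<close>)
  show "set_integrable lborel {x<..y} f" "set_integrable lborel {x..y} f"
    by (rule *; auto)+
qed

text \<open>The intended instance is \<eta>(exp u) for \<open>\<zeta>\<close>, the tail supremum of
  its absolute value for \<open>b\<close>, and a bound of \<eta> for \<open>K\<close>. Letting
  \<open>\<zeta>\<close> vanish at nonpositive arguments makes \<open>G\<close> constant there, so
  that its increments need no sign condition.\<close>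

locale bounded_rate =
  fixes \<zeta> b :: "real \<Rightarrow> real" and K :: real
  assumes \<zeta>_measurable [measurable]: "\<zeta> \<in> borel_measurable borel"
    and \<zeta>_nonpos: "\<And>u. u \<le> 0 \<Longrightarrow> \<zeta> u = 0"
    and antimono_b: "\<And>u v. u \<le> v \<Longrightarrow> b v \<le> b u"
    and \<zeta>_le_b: "\<And>u. \<bar>\<zeta> u\<bar> \<le> b u"
    and b_le_K: "\<And>u. b u \<le> K"
begin

definition G :: "real \<Rightarrow> real" where "G y = (LBINT u:{0..y}. \<zeta> u)"

definition Q :: "real \<Rightarrow> real" where "Q y = (LBINT u:{0..y}. (b u)\<^sup>2 * exp (- u))"

definition m :: "real \<Rightarrow> real" where "m y = (\<integral>z. G (y + z) - G y \<partial>std_exp)"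

lemma b_nonneg: "0 \<le> b u"
  using \<zeta>_le_b[of u] by linarith

lemma b_measurable [measurable]: "b \<in> borel_measurable borel"
proof -
  have "(\<lambda>u. - b u) \<in> borel_measurable borel"
    by (rule borel_measurable_mono) (simp add: mono_def antimono_b)
  then show ?thesis
    by (simp add: borel_measurable_uminus_eq)
qed

lemma b_set_integrable: "set_integrable lborel {x<..y} b"
  by (rule set_integrable_bounded_interval(1)[of _ K]) (use b_nonneg b_le_K in auto)

lemma \<zeta>_set_integrable: "set_integrable lborel {x<..y} \<zeta>" "set_integrable lborel {x..y} \<zeta>"
proof -
  have "\<bar>\<zeta> u\<bar> \<le> K" for u
    using \<zeta>_le_b b_le_K order.trans by blast
  then show "set_integrable lborel {x<..y} \<zeta>" "set_integrable lborel {x..y} \<zeta>"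
    by (intro set_integrable_bounded_interval[of _ K]; simp)+
qed

lemma G_diff:
  assumes "x \<le> y"
  shows "G y - G x = (LBINT u:{x<..y}. \<zeta> u)"
proof -
  have "(LBINT u:{0..y}. \<zeta> u) - (LBINT u:{0..x}. \<zeta> u) = (\<integral>u. indicator {0..y} u *\<^sub>R \<zeta> u - indicator {0..x} u *\<^sub>R \<zeta> u \<partial>lborel)"
    using \<zeta>_set_integrable(2) unfolding set_lebesgue_integral_def set_integrable_def
    by (subst Bochner_Integration.integral_diff) auto
  also have "\<dots> = (LBINT u:{x<..y}. \<zeta> u)"
    unfolding set_lebesgue_integral_def using assms \<zeta>_nonpos
    by (intro Bochner_Integration.integral_cong) (auto split: split_indicator)
  finally show ?thesis by (simp add: G_def)
qed

lemma abs_G_diff_le: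
  assumes "x \<le> y"
  shows "\<bar>G y - G x\<bar> \<le> (LBINT u:{x<..y}. b u)"
proof -
  have "\<bar>LBINT u:{x<..y}. \<zeta> u\<bar> \<le> (LBINT u:{x<..y}. \<bar>\<zeta> u\<bar>)"
    unfolding set_lebesgue_integral_def
    using integral_norm_bound[of lborel "\<lambda>u. indicator {x<..y} u *\<^sub>R \<zeta> u"] by (simp add: abs_mult)
  also have "\<dots> \<le> (LBINT u:{x<..y}. b u)"
    using \<zeta>_le_b set_integrable_abs[OF \<zeta>_set_integrable(1)] b_set_integrable
    by (intro set_integral_mono) auto
  finally show ?thesis using G_diff[OF assms] by simp
qed

lemma integral_b_le:
  assumes "x \<le> y"
  shows "(LBINT u:{x<..y}. b u) \<le> b x * (y - x)"
proof -
  have "(LBINT u:{x<..y}. b u) \<le> (LBINT u:{x<..y}. b x)"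
    using antimono_b b_set_integrable
    by (intro set_integral_mono set_integrable_bounded_interval(1)[of "\<lambda>_. b x" "\<bar>b x\<bar>"]) auto
  also have "\<dots> = b x * (y - x)"
    using assms by (simp add: set_lebesgue_integral_def measure_def)
  finally show ?thesis .
qed

lemma abs_G_diff_le_linear:
  assumes "x \<le> y"
  shows "\<bar>G y - G x\<bar> \<le> b x * (y - x)"
  using abs_G_diff_le[OF assms] integral_b_le[OF assms] by linarith

lemma continuous_G: "continuous_on UNIV G"
proof (rule lipschitz_on_continuous_on)
  have "\<bar>G x - G y\<bar> \<le> \<bar>K\<bar> * \<bar>x - y\<bar>" for x y
  proof (induction x y rule: linorder_wlog)
    case (le x y)
    have "\<bar>G y - G x\<bar> \<le> b x * (y - x)"
      using le by (rule abs_G_diff_le_linear)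
    also have "\<dots> \<le> \<bar>K\<bar> * \<bar>x - y\<bar>"
      using le b_le_K[of x] by (intro mult_mono) auto
    finally show ?case by (simp add: abs_minus_commute)
  qed (simp add: abs_minus_commute)
  then show "\<bar>K\<bar>-lipschitz_on UNIV G"
    by (intro lipschitz_onI) (simp_all add: dist_real_def)
qed

lemma G_measurable [measurable]: "G \<in> borel_measurable borel"
  using continuous_G by (rule borel_measurable_continuous_onI)

text \<open>Moving the window to the right by \<open>z\<close> only decreases \<open>b\<close>, so
  the unshifted window gives a bound uniform in \<open>z\<close>; this controls the increments of
  \<open>m\<close>.\<close>

lemma abs_G_diff_shift_le:
  assumes "x \<le> y" "0 \<le> z"
  shows "\<bar>G (y + z) - G (x + z)\<bar> \<le> (LBINT u:{x<..y}. b u)"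
proof -
  have "\<bar>G (y + z) - G (x + z)\<bar> \<le> (LBINT u:{x + z<..y + z}. b u)"
    using assms by (intro abs_G_diff_le) simp
  also have "\<dots> = (LBINT u:{x<..y}. b (z + u))"
    unfolding set_lebesgue_integral_def
    by (subst lborel_integral_real_affine[where c = 1 and t = z])
      (auto intro!: Bochner_Integration.integral_cong split: split_indicator)
  also have "\<dots> \<le> (LBINT u:{x<..y}. b u)"
    using antimono_b assms(2) b_nonneg b_le_K
    by (intro set_integral_mono b_set_integrable set_integrable_bounded_interval(1)[of _ K]) auto
  finally show ?thesis .
qed

lemma \<beta>_bound: "\<bar>(b u)\<^sup>2 * exp (- u)\<bar> \<le> K\<^sup>2 * exp (- u)"
  using b_nonneg[of u] b_le_K[of u] by (simp add: abs_mult power_mono)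

lemma \<beta>_set_integrable:
  assumes "0 \<le> x"
  shows "set_integrable lborel {x<..y} (\<lambda>u. (b u)\<^sup>2 * exp (- u))"
    "set_integrable lborel {x..y} (\<lambda>u. (b u)\<^sup>2 * exp (- u))"
proof -
  have *: "set_integrable lborel A (\<lambda>u. (b u)\<^sup>2 * exp (- u))" if "A \<in> sets borel" "A \<subseteq> {x..y}" for A
  proof (rule set_integrable_subset[of _ "{x..y}"])
    show "set_integrable lborel {x..y} (\<lambda>u. (b u)\<^sup>2 * exp (- u))"
    proof (rule set_integrable_bound[of _ _ "\<lambda>u. K\<^sup>2 * exp (- u)"])
      show "set_integrable lborel {x..y} (\<lambda>u. K\<^sup>2 * exp (- u))"
        by (rule borel_integrable_atLeastAtMost') (intro continuous_intros)
    qed (use \<beta>_bound in \<open>auto simp: set_borel_measurable_def\<close>)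
  qed (use that in auto)
  show "set_integrable lborel {x<..y} (\<lambda>u. (b u)\<^sup>2 * exp (- u))"
    "set_integrable lborel {x..y} (\<lambda>u. (b u)\<^sup>2 * exp (- u))"
    by (rule *; auto)+
qed

lemma Q_diff:
  assumes "0 \<le> x" "x \<le> y"
  shows "Q y - Q x = (LBINT u:{x<..y}. (b u)\<^sup>2 * exp (- u))"
proof -
  have "(LBINT u:{0..y}. (b u)\<^sup>2 * exp (- u)) - (LBINT u:{0..x}. (b u)\<^sup>2 * exp (- u))
      = (\<integral>u. indicator {0..y} u *\<^sub>R ((b u)\<^sup>2 * exp (- u)) - indicator {0..x} u *\<^sub>R ((b u)\<^sup>2 * exp (- u)) \<partial>lborel)"
    using \<beta>_set_integrable(2)[of 0] unfolding set_lebesgue_integral_def set_integrable_def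
    by (subst Bochner_Integration.integral_diff) auto
  also have "\<dots> = (LBINT u:{x<..y}. (b u)\<^sup>2 * exp (- u))"
    unfolding set_lebesgue_integral_def using assms
    by (intro Bochner_Integration.integral_cong) (auto split: split_indicator)
  finally show ?thesis by (simp add: Q_def)
qed

lemma integral_exp_Ioc:
  assumes "x \<le> y"
  shows "(LBINT u:{x<..y}. exp u) = exp y - exp (x::real)" "set_integrable lborel {x<..y} (\<lambda>u. exp u :: real)"
proof -
  have *: "has_bochner_integral lborel (\<lambda>u. exp u * indicator {x..y} u) (exp y - exp x)"
    by (rule has_bochner_integral_FTC_Icc_real) (use assms in \<open>auto intro!: derivative_eq_intros\<close>)
  have "AE u in lborel. exp u * indicator {x..y} u = indicator {x<..y} u *\<^sub>R exp u"
    using AE_lborel_singleton[of x] by eventually_elim (auto split: split_indicator)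
  then have "has_bochner_integral lborel (\<lambda>u. indicator {x<..y} u *\<^sub>R exp u) (exp y - exp x)"
    using * by (subst (asm) has_bochner_integral_cong_AE) auto
  then show "(LBINT u:{x<..y}. exp u) = exp y - exp x" "set_integrable lborel {x<..y} (\<lambda>u. exp u :: real)"
    by (auto simp: has_bochner_integral_iff set_lebesgue_integral_def set_integrable_def)
qed

text \<open>The inequality for the splitting of b into b exp(-u/2) times exp(u/2), proved by
  integrating a nonnegative square.\<close>

lemma integral_b_Cauchy_Schwarz:
  assumes "0 \<le> x" "x \<le> y"
  shows "(LBINT u:{x<..y}. b u)\<^sup>2 \<le> (exp y - exp x) * (Q y - Q x)"
proof (cases "x = y")
  case True
  then show ?thesis by (simp add: set_lebesgue_integral_def)
next
  case False
  define I where "I = (LBINT u:{x<..y}. b u)"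
  define A where "A = exp y - exp x"
  have A: "0 < A"
    using False assms by (simp add: A_def)
  \<comment> \<open>The coefficient \<open>I / A\<close> is the one that minimises the integral of
    exp(-u) (b u - s exp u)^2 over s.\<close>
  have "0 \<le> (LBINT u:{x<..y}. (b u)\<^sup>2 * exp (- u) - 2 * (I / A) * b u + (I / A)\<^sup>2 * exp u)"
  proof (unfold set_lebesgue_integral_def, rule Bochner_Integration.integral_nonneg)
    fix u
    have "(b u)\<^sup>2 * exp (- u) - 2 * (I / A) * b u + (I / A)\<^sup>2 * exp u = exp (- u) * (b u - (I / A) * exp u)\<^sup>2"
      by (simp add: power2_eq_square algebra_simps exp_minus)
    then show "0 \<le> indicator {x<..y} u *\<^sub>R ((b u)\<^sup>2 * exp (- u) - 2 * (I / A) * b u + (I / A)\<^sup>2 * exp u)"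
      by simp
  qed
  also have "\<dots> = (Q y - Q x) - 2 * (I / A) * I + (I / A)\<^sup>2 * A"
    unfolding Q_diff[OF assms] I_def A_def integral_exp_Ioc(1)[OF assms(2), symmetric]
    using \<beta>_set_integrable(1)[OF assms(1)] b_set_integrable integral_exp_Ioc(2)[OF assms(2)]
    by simp
  also have "\<dots> = (Q y - Q x) - I\<^sup>2 / A"
    using A by (simp add: power2_eq_square field_simps)
  finally show ?thesis
    using A by (simp add: I_def A_def field_simps)
qed

end

section \<open>Moments of the exponential law and of its Lipschitz perturbations\<close>

lemma std_exp_moment:
  "integrable std_exp (\<lambda>z. z ^ i)" "(\<integral>z. z ^ i \<partial>std_exp) = fact i"
proof -
  interpret prob_space std_exp by (rule prob_space_std_exp)
  have "distributed std_exp lborel (\<lambda>z. z) (exponential_density 1)"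
    by (auto simp: distributed_def distr_id2 sets_eq_imp_space_eq)
  then show "integrable std_exp (\<lambda>z. z ^ i)" "(\<integral>z. z ^ i \<partial>std_exp) = fact i"
    using erlang_ith_moment_integrable[of 1 "\<lambda>z. z" 0 i] erlang_ith_moment[of 1 "\<lambda>z. z" 0 i] by simp_all
qed

lemma std_exp_centred_moments:
  "integrable std_exp (\<lambda>z. z - 1)" "(\<integral>z. z - 1 \<partial>std_exp) = 0"
  "integrable std_exp (\<lambda>z. (z - 1)\<^sup>2)" "(\<integral>z. (z - 1)\<^sup>2 \<partial>std_exp) = 1"
proof -
  interpret prob_space std_exp by (rule prob_space_std_exp)
  have 1: "integrable std_exp (\<lambda>z. z)" "(\<integral>z. z \<partial>std_exp) = 1"
    using std_exp_moment[of 1] by simp_all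
  have 2: "integrable std_exp (\<lambda>z. z\<^sup>2)" "(\<integral>z. z\<^sup>2 \<partial>std_exp) = 2"
    using std_exp_moment[of 2] by (simp_all add: numeral_2_eq_2)
  show "integrable std_exp (\<lambda>z. z - 1)" "(\<integral>z. z - 1 \<partial>std_exp) = 0"
    using 1 prob_space by simp_all
  show "integrable std_exp (\<lambda>z. (z - 1)\<^sup>2)" "(\<integral>z. (z - 1)\<^sup>2 \<partial>std_exp) = 1"
    unfolding power2_diff using 1 2 prob_space by simp_all
qed

text \<open>Centring the perturbation at its value at the mean \<open>1\<close> of the exponential law bounds both its
  covariance with the identity and its variance by the variance \<open>1\<close>.\<close>

lemma variance_perturbed_std_exp:
  fixes \<delta> :: "real \<Rightarrow> real"
  assumes [measurable]: "\<delta> \<in> borel_measurable borel"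
    and lip: "\<And>z. 0 < z \<Longrightarrow> \<bar>\<delta> z - \<delta> 1\<bar> \<le> \<beta> * \<bar>z - 1\<bar>" and "0 \<le> \<gamma>" "0 \<le> \<beta>"
  shows "integrable std_exp (\<lambda>z. (\<gamma> * z + \<delta> z)\<^sup>2)"
    and "\<gamma>\<^sup>2 - 2 * \<gamma> * \<beta> \<le> prob_space.variance std_exp (\<lambda>z. \<gamma> * z + \<delta> z)"
    and "prob_space.variance std_exp (\<lambda>z. \<gamma> * z + \<delta> z) \<le> \<gamma>\<^sup>2 + 2 * \<gamma> * \<beta> + \<beta>\<^sup>2"
proof -
  interpret prob_space std_exp by (rule prob_space_std_exp)
  define e where "e z = \<delta> z - \<delta> 1" for z
  have [measurable]: "e \<in> borel_measurable borel"
    unfolding e_def by measurable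
  have e_le: "AE z in std_exp. \<bar>e z\<bar> \<le> \<beta> * \<bar>z - 1\<bar>"
    using AE_std_exp_pos by eventually_elim (simp add: e_def lip)
  \<comment> \<open>Both error terms are compared with the squared deviation of \<open>z\<close>
    from its mean, whose integral is 1.\<close>
  then have e_sq: "AE z in std_exp. (e z)\<^sup>2 \<le> \<beta>\<^sup>2 * (z - 1)\<^sup>2"
    by eventually_elim (metis abs_ge_zero power2_abs power_mono power_mult_distrib)
  from e_le have e_prod: "AE z in std_exp. \<bar>(z - 1) * e z\<bar> \<le> \<beta> * (z - 1)\<^sup>2"
  proof eventually_elim
    case (elim z)
    have "\<bar>z - 1\<bar> * \<bar>e z\<bar> \<le> \<bar>z - 1\<bar> * (\<beta> * \<bar>z - 1\<bar>)"
      using elim by (intro mult_left_mono) auto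
    then show ?case
      by (simp add: abs_mult power2_eq_square abs_mult_self_eq mult_ac)
  qed
  note cm = std_exp_centred_moments
  have int_e2: "integrable std_exp (\<lambda>z. (e z)\<^sup>2)"
    using e_sq by (intro Bochner_Integration.integrable_bound[OF integrable_mult_right[OF cm(3), of "\<beta>\<^sup>2"]]) auto
  have int_e: "integrable std_exp e"
    using int_e2 by (rule square_integrable_imp_integrable[rotated]) simp
  have int_p: "integrable std_exp (\<lambda>z. (z - 1) * e z)"
    using e_prod assms(4) by (intro Bochner_Integration.integrable_bound[OF integrable_mult_right[OF cm(3), of \<beta>]]) auto
  have E_p: "\<bar>expectation (\<lambda>z. (z - 1) * e z)\<bar> \<le> \<beta>"
  proof -
    have "\<bar>expectation (\<lambda>z. (z - 1) * e z)\<bar> \<le> expectation (\<lambda>z. \<bar>(z - 1) * e z\<bar>)"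
      using integral_norm_bound[of std_exp "\<lambda>z. (z - 1) * e z"] by simp
    also have "\<dots> \<le> expectation (\<lambda>z. \<beta> * (z - 1)\<^sup>2)"
      using e_prod int_p cm by (intro integral_mono_AE) auto
    finally show ?thesis using cm by simp
  qed
  have E_e2: "expectation (\<lambda>z. (e z)\<^sup>2) \<le> \<beta>\<^sup>2"
  proof -
    have "expectation (\<lambda>z. (e z)\<^sup>2) \<le> expectation (\<lambda>z. \<beta>\<^sup>2 * (z - 1)\<^sup>2)"
      using e_sq int_e2 cm by (intro integral_mono_AE) auto
    then show ?thesis using cm by simp
  qed
  define V where "V z = \<gamma> * (z - 1) + e z" for z
  define c where "c = \<gamma> + \<delta> 1"
  \<comment> \<open>The constant \<open>c\<close> does not affect the variance, and since
    \<open>z - 1\<close> is centred, the mean of \<open>V\<close> is that of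
    \<open>e\<close>.\<close>
  have V: "\<gamma> * z + \<delta> z = V z + c" for z
    by (simp add: V_def c_def e_def algebra_simps)
  have V_sq: "(V z)\<^sup>2 = \<gamma>\<^sup>2 * (z - 1)\<^sup>2 + 2 * \<gamma> * ((z - 1) * e z) + (e z)\<^sup>2" for z
    by (simp add: V_def power2_eq_square algebra_simps)
  have int_V: "integrable std_exp V" "integrable std_exp (\<lambda>z. (V z)\<^sup>2)"
    unfolding V_sq using int_e int_e2 int_p cm by (auto simp: V_def[abs_def])
  have E_V: "expectation V = expectation e"
    using int_e cm by (simp add: V_def[abs_def])
  have E_V2: "expectation (\<lambda>z. (V z)\<^sup>2) = \<gamma>\<^sup>2 + 2 * \<gamma> * expectation (\<lambda>z. (z - 1) * e z) + expectation (\<lambda>z. (e z)\<^sup>2)"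
    unfolding V_sq using int_e2 int_p cm by simp
  show "integrable std_exp (\<lambda>z. (\<gamma> * z + \<delta> z)\<^sup>2)"
    unfolding V power2_sum using int_V by simp
  have var: "variance (\<lambda>z. \<gamma> * z + \<delta> z) = expectation (\<lambda>z. (V z)\<^sup>2) - (expectation V)\<^sup>2"
  proof -
    have "variance (\<lambda>z. \<gamma> * z + \<delta> z) = variance V"
      unfolding V using int_V prob_space by simp
    then show ?thesis using int_V by (simp add: variance_eq)
  qed
  have abs_le: "\<bar>2 * \<gamma> * expectation (\<lambda>z. (z - 1) * e z)\<bar> \<le> 2 * \<gamma> * \<beta>"
    using E_p assms(3) by (simp add: abs_mult mult_left_mono)
  show "variance (\<lambda>z. \<gamma> * z + \<delta> z) \<le> \<gamma>\<^sup>2 + 2 * \<gamma> * \<beta> + \<beta>\<^sup>2"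
    using abs_le E_e2 unfolding var E_V2 by (smt (verit) zero_le_power2)
  have "0 \<le> expectation (\<lambda>z. (e z)\<^sup>2) - (expectation e)\<^sup>2"
    using variance_positive[of e] int_e int_e2 by (simp add: variance_eq)
  then show "\<gamma>\<^sup>2 - 2 * \<gamma> * \<beta> \<le> variance (\<lambda>z. \<gamma> * z + \<delta> z)"
    using abs_le unfolding var E_V2 E_V by linarith
qed

section \<open>Conditional mean and variance of one increment\<close>

context bounded_rate
begin

lemma abs_increment_le: "0 < z \<Longrightarrow> \<bar>G (y + z) - G y\<bar> \<le> b y * z"
  using abs_G_diff_le_linear[of y "y + z"] by simp

lemma integrable_increment: "integrable std_exp (\<lambda>z. G (y + z) - G y)"
proof (rule Bochner_Integration.integrable_bound)
  show "integrable std_exp (\<lambda>z. b y * z)"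
    using std_exp_moment(1)[of 1] by simp
  show "AE z in std_exp. norm (G (y + z) - G y) \<le> norm (b y * z)"
    using AE_std_exp_pos by eventually_elim (metis abs_increment_le abs_ge_self order.trans real_norm_def)
qed measurable

lemma abs_m_le: "\<bar>m y\<bar> \<le> b y"
proof -
  have "\<bar>m y\<bar> \<le> (\<integral>z. \<bar>G (y + z) - G y\<bar> \<partial>std_exp)"
    using integral_norm_bound[of std_exp "\<lambda>z. G (y + z) - G y"] by (simp add: m_def)
  also have "\<dots> \<le> (\<integral>z. b y * z \<partial>std_exp)"
    using AE_std_exp_pos integrable_increment std_exp_moment(1)[of 1] abs_increment_le
    by (intro integral_mono_AE) (auto elim: eventually_mono)
  also have "\<dots> = b y"
    using std_exp_moment(2)[of 1] by simp
  finally show ?thesis .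
qed

lemma m_measurable [measurable]: "m \<in> borel_measurable borel"
proof -
  interpret prob_space std_exp by (rule prob_space_std_exp)
  show ?thesis unfolding m_def by measurable
qed

text \<open>The factor 2 arises because the difference of increments regroups into a shifted and an
  unshifted increment of \<open>G\<close> from \<open>x\<close> to \<open>y\<close>, each bounded by
  the same integral of \<open>b\<close>.\<close>

lemma abs_m_diff_le:
  assumes "x \<le> y"
  shows "\<bar>m y - m x\<bar> \<le> 2 * (LBINT u:{x<..y}. b u)"
proof -
  interpret prob_space std_exp by (rule prob_space_std_exp)
  let ?I = "LBINT u:{x<..y}. b u"
  have "\<bar>m y - m x\<bar> = \<bar>\<integral>z. (G (y + z) - G (x + z)) - (G y - G x) \<partial>std_exp\<bar>"
    unfolding m_def
    by (subst Bochner_Integration.integral_diff[symmetric], (rule integrable_increment)+)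
      (simp add: algebra_simps)
  also have "\<dots> \<le> (\<integral>z. \<bar>(G (y + z) - G (x + z)) - (G y - G x)\<bar> \<partial>std_exp)"
    using integral_norm_bound[of std_exp "\<lambda>z. (G (y + z) - G (x + z)) - (G y - G x)"] by simp
  also have "\<dots> \<le> (\<integral>z. 2 * ?I \<partial>std_exp)"
  proof (rule integral_mono_AE)
    have "integrable std_exp (\<lambda>z. (G (y + z) - G y) - (G (x + z) - G x))"
      by (intro Bochner_Integration.integrable_diff integrable_increment)
    then show "integrable std_exp (\<lambda>z. \<bar>(G (y + z) - G (x + z)) - (G y - G x)\<bar>)"
      by (simp add: algebra_simps)
    show "AE z in std_exp. \<bar>(G (y + z) - G (x + z)) - (G y - G x)\<bar> \<le> 2 * ?I"
      using AE_std_exp_pos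
    proof eventually_elim
      case (elim z)
      show ?case
        using abs_G_diff_shift_le[OF assms, of z] abs_G_diff_shift_le[OF assms, of 0] elim by simp
    qed
  qed simp
  finally show ?thesis using prob_space by simp
qed

text \<open>Both factors on the right change sign together when \<open>x\<close> and
  \<open>y\<close> are exchanged, so no order is assumed. This matters because the order statistic
  falls on either side of the point used for centring.\<close>

lemma m_diff_square_le:
  assumes "0 \<le> x" "0 \<le> y"
  shows "(m y - m x)\<^sup>2 \<le> 4 * ((exp y - exp x) * (Q y - Q x))"
  using assms
proof (induction x y rule: linorder_wlog)
  case (le x y)
  have "(m y - m x)\<^sup>2 \<le> (2 * (LBINT u:{x<..y}. b u))\<^sup>2"
    using abs_m_diff_le[OF le(1)] by (metis abs_ge_zero power2_abs power_mono)
  also have "\<dots> \<le> 4 * ((exp y - exp x) * (Q y - Q x))"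
    using integral_b_Cauchy_Schwarz[OF le(2,1)] by (simp add: power_mult_distrib)
  finally show ?case .
next
  case (sym x y)
  then show ?case by (simp add: power2_commute algebra_simps)
qed

lemma increment_variance:
  fixes y \<gamma> :: real
  assumes "0 \<le> \<gamma>"
  defines "D \<equiv> \<lambda>z. \<gamma> * z + (G (y + z) - G y)"
  shows "integrable std_exp (\<lambda>z. (D z)\<^sup>2)"
    and "\<gamma>\<^sup>2 - 2 * \<gamma> * b y \<le> prob_space.variance std_exp D"
    and "prob_space.variance std_exp D \<le> \<gamma>\<^sup>2 + 2 * \<gamma> * b y + (b y)\<^sup>2"
    and "(\<integral>z. D z \<partial>std_exp) = \<gamma> + m y"
proof -
  \<comment> \<open>On whichever side of 1 the point \<open>z\<close> lies, the increment is taken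
    beyond \<open>y\<close>, where \<open>b y\<close> bounds the slope of \<open>G\<close>.\<close>
  have lip: "\<bar>(G (y + z) - G y) - (G (y + 1) - G y)\<bar> \<le> b y * \<bar>z - 1\<bar>" if "0 < z" for z
  proof (cases "z \<le> 1")
    case True
    then have "\<bar>G (y + 1) - G (y + z)\<bar> \<le> b (y + z) * (1 - z)"
      using abs_G_diff_le_linear[of "y + z" "y + 1"] by simp
    also have "\<dots> \<le> b y * \<bar>z - 1\<bar>"
      using antimono_b[of y "y + z"] that True by (intro mult_mono) (auto simp: b_nonneg)
    finally show ?thesis by (simp add: abs_minus_commute)
  next
    case False
    then have "\<bar>G (y + z) - G (y + 1)\<bar> \<le> b (y + 1) * (z - 1)"
      using abs_G_diff_le_linear[of "y + 1" "y + z"] by simp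
    also have "\<dots> \<le> b y * \<bar>z - 1\<bar>"
      using antimono_b[of y "y + 1"] False by (intro mult_mono) (auto simp: b_nonneg)
    finally show ?thesis by simp
  qed
  show "integrable std_exp (\<lambda>z. (D z)\<^sup>2)" "\<gamma>\<^sup>2 - 2 * \<gamma> * b y \<le> prob_space.variance std_exp D"
    "prob_space.variance std_exp D \<le> \<gamma>\<^sup>2 + 2 * \<gamma> * b y + (b y)\<^sup>2"
    unfolding D_def using variance_perturbed_std_exp[of "\<lambda>z. G (y + z) - G y" "b y" \<gamma>, OF _ lip assms(1) b_nonneg]
    by simp_all
  show "(\<integral>z. D z \<partial>std_exp) = \<gamma> + m y"
    using integrable_increment std_exp_moment[of 1] by (simp add: D_def m_def del: Bochner_Integration.integral_diff)
qed

end

section \<open>The law of an order statistic of an exponential sample\<close>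

abbreviation order_law :: "nat \<Rightarrow> nat \<Rightarrow> real measure" where
  "order_law n k \<equiv> density lborel (order_density n k)"

lemma nn_integral_order_law:
  assumes "\<phi> \<in> borel_measurable borel"
  shows "(\<integral>\<^sup>+t. \<phi> t \<partial>order_law n k) = (\<integral>\<^sup>+t. ennreal (order_density n k t) * \<phi> t \<partial>lborel)"
  using assms by (subst nn_integral_density) simp_all

text \<open>The constant test function 1 in \<open>nn_integral_order_stats\<close> gives the
  normalisation, with no beta integral to compute.\<close>

lemma prob_space_order_law:
  assumes "k < n"
  shows "prob_space (order_law n k)"
proof
  interpret P: prob_space "Pi\<^sub>M {..<n} (\<lambda>_. std_exp)"
    by (intro prob_space_PiM prob_space_std_exp)
  have "prob_space (Pi\<^sub>M S (\<lambda>_. std_exp))" for S :: "nat set"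
    by (intro prob_space_PiM prob_space_std_exp)
  then have "(\<integral>\<^sup>+t. ennreal (order_density n k t) * 1 \<partial>lborel) = 1"
    using nn_integral_order_stats[OF assms, of "\<lambda>_ _. 1" "\<lambda>_ _. 0" "\<lambda>_. 1"]
    by (simp add: P.emeasure_space_1 prob_space.emeasure_space_1)
  then show "emeasure (order_law n k) (space (order_law n k)) = 1"
    by (simp add: emeasure_density)
qed

lemma AE_order_law_pos: "AE t in order_law n k. 0 < t"
  by (subst AE_density) (auto simp: order_density_def)

text \<open>For \<open>k\<close> at least 1 the density is of order exp(-2x), which leaves room for
  a factor of growth exp(x); for \<open>k = 0\<close> that room is missing.\<close>

lemma integrable_order_density:
  fixes f :: "real \<Rightarrow> real"
  assumes "1 \<le> k" and [measurable]: "f \<in> borel_measurable borel"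
    and "\<And>x. 0 < x \<Longrightarrow> \<bar>f x\<bar> \<le> L * exp x"
  shows "integrable lborel (\<lambda>x. order_density n k x * f x)"
proof (rule Bochner_Integration.integrable_bound)
  define C where "C = real (card (splits n k))"
  show "integrable lborel (\<lambda>x. C * L * exponential_density 1 x)"
    using integrable_exponential_density by simp
  show "AE x in lborel. norm (order_density n k x * f x) \<le> norm (C * L * exponential_density 1 x)"
  proof (rule always_eventually, rule allI)
    fix x :: real
    show "norm (order_density n k x * f x) \<le> norm (C * L * exponential_density 1 x)"
    proof (cases "0 < x")
      case True
      have "exp (- (real k + 1) * x) * (1 - exp (- x)) ^ (n - k - 1) \<le> exp (- 2 * x) * 1"
      proof (intro mult_mono power_le_one)
        have "2 * x \<le> (real k + 1) * x"
          using True assms(1) by (intro mult_right_mono) auto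
        then show "exp (- (real k + 1) * x) \<le> exp (- 2 * x)" by (simp only: exp_le_cancel_iff mult_minus_left neg_le_iff_le)
      qed (use True in auto)
      then have "C * (exp (- (real k + 1) * x) * (1 - exp (- x)) ^ (n - k - 1)) \<le> C * exp (- 2 * x)"
        by (intro mult_left_mono) (simp_all add: C_def)
      then have "order_density n k x * \<bar>f x\<bar> \<le> (C * exp (- 2 * x)) * (L * exp x)"
        using True assms(3) by (intro mult_mono) (auto simp: order_density_def C_def mult.assoc)
      also have "\<dots> = C * L * exp (- x)"
        by (simp flip: exp_add)
      also have "\<dots> \<le> \<bar>C * L\<bar> * exp (- x)"
        by (intro mult_right_mono) auto
      finally show ?thesis
        using True by (simp add: exponential_density_def abs_mult order_density_nonneg)
    qed (simp add: order_density_def)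
  qed
qed measurable

lemma integrable_order_law:
  fixes f :: "real \<Rightarrow> real"
  assumes "1 \<le> k" "f \<in> borel_measurable borel" "\<And>x. 0 < x \<Longrightarrow> \<bar>f x\<bar> \<le> L * exp x"
  shows "integrable (order_law n k) f"
  using integrable_order_density[OF assms] assms(2)
  by (subst integrable_density) (auto simp: order_density_nonneg)

lemma integral_order_law:
  fixes f :: "real \<Rightarrow> real"
  assumes "f \<in> borel_measurable borel"
  shows "(\<integral>x. f x \<partial>order_law n k) = (\<integral>x. order_density n k x * f x \<partial>lborel)"
  using assms by (subst integral_density) (auto simp: order_density_nonneg)

text \<open>Up to the factor \<open>1 / k\<close>, this is the Stein kernel of the law of \<open>Y\<^sub>(\<^sub>k\<^sub>+\<^sub>1\<^sub>)\<close> for the test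
  function \<open>exp\<close>, whose mean is \<open>n / k\<close>.\<close>

definition order_stein :: "nat \<Rightarrow> nat \<Rightarrow> real \<Rightarrow> real" where
  "order_stein n k u = real (card (splits n k)) * (exp (- (real k * u)) * (1 - exp (- u)) ^ (n - k))"

text \<open>The closed form serves as the definition because it is continuous on the whole line,
  including the point 0 at which \<open>order_density\<close> is cut off. The product form is the
  one to compare with the density.\<close>

lemma order_stein_eq:
  assumes "k < n" "0 < u"
  shows "order_stein n k u = order_density n k u * (exp u - 1)"
proof -
  define R where "R = (1 - exp (- u)) ^ (n - k - 1)"
  have pow: "(1 - exp (- u)) ^ (n - k) = (1 - exp (- u)) * R"
    using assms(1) by (simp add: R_def Suc_diff_Suc flip: power_Suc)
  have e: "exp (- (real k + 1) * u) * (exp u - 1) = exp (- (real k * u)) * (1 - exp (- u))"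
    by (simp add: algebra_simps flip: exp_add)
  have "order_density n k u * (exp u - 1)
      = real (card (splits n k)) * (exp (- (real k + 1) * u) * (exp u - 1)) * R"
    using assms(2) by (simp add: order_density_def R_def)
  also have "\<dots> = order_stein n k u"
    unfolding e by (simp add: order_stein_def pow)
  finally show ?thesis ..
qed

lemma DERIV_order_stein:
  assumes "k < n" "0 < u"
  shows "(order_stein n k has_real_derivative order_density n k u * (real n - real k * exp u)) (at u)"
proof -
  define N where "N = n - k - 1"
  have nk: "n - k = Suc N" "real n = real k + real N + 1"
    using assms(1) by (auto simp: N_def)
  have e: "exp (- (real k + 1) * u) = exp (- (real k * u)) * exp (- u)" "exp (- u) * exp u = 1"
    by (simp_all add: algebra_simps flip: exp_add)
  have "((\<lambda>u. (1 - exp (- u)) ^ Suc N) has_real_derivative (1 + real N) * (exp (- u) * (1 - exp (- u)) ^ N)) (at u)"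
    by (rule DERIV_power_Suc) (auto intro!: derivative_eq_intros)
  then have pow: "((\<lambda>u. (1 - exp (- u)) ^ Suc N) has_real_derivative real (Suc N) * (1 - exp (- u)) ^ N * exp (- u)) (at u)"
    by (rule DERIV_cong) (simp add: mult_ac)
  have "((\<lambda>u. exp (- (real k * u))) has_real_derivative exp (- (real k * u)) * (- real k)) (at u)"
    by (auto intro!: derivative_eq_intros)
  note DERIV_cmult[OF DERIV_mult'[OF this pow], of "real (card (splits n k))"]
  then have "(order_stein n k has_real_derivative
      real (card (splits n k)) * (exp (- (real k * u)) * (- real k) * (1 - exp (- u)) ^ Suc N
        + exp (- (real k * u)) * (real (Suc N) * (1 - exp (- u)) ^ N * exp (- u)))) (at u)"
    unfolding order_stein_def[abs_def] nk(1) by (rule DERIV_cong) (simp only: add.commute)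
  also have "real (card (splits n k)) * (exp (- (real k * u)) * (- real k) * (1 - exp (- u)) ^ Suc N
        + exp (- (real k * u)) * (real (Suc N) * (1 - exp (- u)) ^ N * exp (- u)))
      = real (card (splits n k)) * exp (- (real k * u)) * (1 - exp (- u)) ^ N
        * (- real k * (1 - exp (- u)) + real (Suc N) * exp (- u))"
    by (simp add: algebra_simps)
  \<comment> \<open>The two terms of the product rule recombine because
    \<open>k + Suc N = n\<close>.\<close>
  also have "- real k * (1 - exp (- u)) + real (Suc N) * exp (- u) = exp (- u) * real n - real k * (exp (- u) * exp u)"
    by (simp only: nk e of_nat_Suc) (simp add: algebra_simps)
  also have "\<dots> = exp (- u) * (real n - real k * exp u)"
    by (simp add: algebra_simps)
  also have "real (card (splits n k)) * exp (- (real k * u)) * (1 - exp (- u)) ^ N * (exp (- u) * (real n - real k * exp u))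
      = order_density n k u * (real n - real k * exp u)"
    using assms(2) unfolding order_density_def e(1) by (simp add: N_def)
  finally show ?thesis .
qed

lemma abs_stein_factor_le:
  fixes n k :: nat
  assumes "0 < x"
  shows "\<bar>real n - real k * exp x\<bar> \<le> (real n + real k) * exp x"
proof -
  have "\<bar>real n - real k * exp x\<bar> \<le> real n * 1 + real k * exp x"
    by (simp add: abs_le_iff)
  also have "\<dots> \<le> real n * exp x + real k * exp x"
    using assms by (intro add_right_mono mult_left_mono) auto
  finally show ?thesis by (simp add: algebra_simps)
qed

text \<open>The fundamental theorem of calculus on the half-line beyond \<open>u\<close>. At
  \<open>u = 0\<close> the right-hand side vanishes, since \<open>k < n\<close>, which says that the
  order law gives \<open>exp\<close> the mean n / k.\<close>

lemma integral_order_stein: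
  assumes "1 \<le> k" "k < n" "0 \<le> u"
  shows "(LBINT x:{u<..}. order_density n k x * (real n - real k * exp x)) = - order_stein n k u"
proof -
  let ?h = "\<lambda>x. order_density n k x * (real n - real k * exp x)"
  have "integrable lborel ?h"
    using assms(1) abs_stein_factor_le by (intro integrable_order_density[where L = "real n + real k"]) auto
  then have int: "set_integrable lborel {u<..} ?h"
    unfolding set_integrable_def by (intro integrable_mult_indicator) auto
  \<comment> \<open>Near a positive point the density coincides with its smooth closed form; points
    beyond \<open>u\<close> are positive because \<open>u\<close> is nonnegative.\<close>
  have cont: "isCont ?h x" if "0 < x" for x
  proof -
    have "isCont (order_density n k) x \<longleftrightarrow>
        isCont (\<lambda>t. real (card (splits n k)) * exp (- (real k + 1) * t) * (1 - exp (- t)) ^ (n - k - 1)) x"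
      using that eventually_nhds_in_open[of "{0<..}" x]
      by (intro isCont_cong) (auto elim!: eventually_mono simp: order_density_def)
    moreover have "isCont (\<lambda>t. real (card (splits n k)) * exp (- (real k + 1) * t) * (1 - exp (- t)) ^ (n - k - 1)) x"
      by (intro continuous_intros)
    ultimately show ?thesis
      by (intro continuous_intros) auto
  qed
  have "(LBINT x=ereal u..\<infinity>. ?h x) = 0 - order_stein n k u"
  proof (rule interval_integral_FTC_integrable)
    show "(order_stein n k has_vector_derivative ?h x) (at x)" if "ereal u < ereal x" for x
      using DERIV_order_stein[OF assms(2), of x] that assms(3)
      by (simp add: has_real_derivative_iff_has_vector_derivative)
    show "isCont ?h x" if "ereal u < ereal x" for x
      using cont[of x] that assms(3) by simp
    show "set_integrable lborel (einterval (ereal u) \<infinity>) ?h"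
      using int by simp
    show "((order_stein n k \<circ> real_of_ereal) \<longlongrightarrow> order_stein n k u) (at_right (ereal u))"
    proof -
      have "isCont (order_stein n k) u"
        unfolding order_stein_def[abs_def] by (intro continuous_intros)
      then have "(order_stein n k \<longlongrightarrow> order_stein n k u) (at_right u)"
        by (simp add: isCont_def filterlim_at_split)
      then show ?thesis by (simp add: ereal_tendsto_simps)
    qed
    \<comment> \<open>The boundary term at infinity vanishes because of the factor exp(-k u) with
      \<open>k\<close> at least 1.\<close>
    show "((order_stein n k \<circ> real_of_ereal) \<longlongrightarrow> 0) (at_left \<infinity>)"
    proof -
      have "((\<lambda>u. real (card (splits n k)) * (exp (- (real k * u)) * (1 - exp (- u)) ^ (n - k))) \<longlongrightarrow>
          real (card (splits n k)) * (0 * (1 - 0) ^ (n - k))) at_top"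
        using assms(1)
        by (intro tendsto_intros filterlim_compose[OF exp_at_bot] filterlim_tendsto_pos_mult_at_top
            filterlim_uminus_at_bot_at_top[THEN filterlim_compose])
          (auto intro!: filterlim_tendsto_pos_mult_at_top[OF tendsto_const] filterlim_ident
            filterlim_uminus_at_bot_at_top)
      then show ?thesis
        by (simp add: ereal_tendsto_simps order_stein_def[abs_def])
    qed
  qed simp
  then show ?thesis
    by (simp add: interval_lebesgue_integral_def)
qed

section \<open>Variance of the conditional mean, by integration by parts\<close>

context bounded_rate
begin

text \<open>The integrand of \<open>Q\<close>, cut off at 0 so that it is integrable on the whole
  line and Fubini's theorem applies without a lower limit.\<close>

definition \<beta> :: "real \<Rightarrow> real" where "\<beta> u = indicator {0..} u * ((b u)\<^sup>2 * exp (- u))"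

lemma \<beta>_nonneg: "0 \<le> \<beta> u"
  by (simp add: \<beta>_def)

lemma \<beta>_measurable [measurable]: "\<beta> \<in> borel_measurable borel"
  unfolding \<beta>_def by measurable

lemma integrable_\<beta>: "integrable lborel \<beta>"
proof (rule Bochner_Integration.integrable_bound)
  show "integrable lborel (\<lambda>x. K\<^sup>2 * exponential_density 1 x)"
    using integrable_exponential_density by simp
  show "AE u in lborel. norm (\<beta> u) \<le> norm (K\<^sup>2 * exponential_density 1 u)"
    using \<beta>_bound by (auto simp: \<beta>_def exponential_density_def indicator_def)
qed measurable

lemma Q_eq: "Q x = (\<integral>u. indicator {..x} u * \<beta> u \<partial>lborel)"
  unfolding Q_def set_lebesgue_integral_def \<beta>_def
  by (intro Bochner_Integration.integral_cong) (auto split: split_indicator)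

lemma integrable_Q: "integrable lborel (\<lambda>u. indicator {..x} u * \<beta> u)"
  using integrable_mult_indicator[OF _ integrable_\<beta>, of "{..x}"] by simp

lemma Q_measurable [measurable]: "Q \<in> borel_measurable borel"
proof (rule borel_measurable_mono, rule monoI)
  fix x y :: real assume "x \<le> y"
  then show "Q x \<le> Q y"
    unfolding Q_eq by (intro integral_mono integrable_Q) (auto simp: \<beta>_nonneg split: split_indicator)
qed

lemma abs_Q_le: "\<bar>Q x\<bar> \<le> (\<integral>u. \<beta> u \<partial>lborel)"
proof -
  have "0 \<le> Q x"
    unfolding Q_eq by (intro Bochner_Integration.integral_nonneg) (simp add: \<beta>_nonneg)
  moreover have "Q x \<le> (\<integral>u. \<beta> u \<partial>lborel)"
    unfolding Q_eq by (intro integral_mono integrable_Q integrable_\<beta>) (auto simp: \<beta>_nonneg split: split_indicator)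
  ultimately show ?thesis by simp
qed

text \<open>An integration by parts done with Fubini's theorem, since \<open>Q\<close> need not be
  differentiable where \<open>b\<close> jumps: \<open>Q x\<close> is written as the integral of
  \<open>\<beta>\<close> up to \<open>x\<close>, and after the exchange the inner integral is the
  one in \<open>integral_order_stein\<close>.\<close>

lemma integral_stein_Q:
  assumes k: "1 \<le> k" "k < n"
  shows "(\<integral>x. order_density n k x * ((real n - real k * exp x) * Q x) \<partial>lborel)
    = - (\<integral>u. order_stein n k u * \<beta> u \<partial>lborel)"
proof -
  define h where "h x = order_density n k x * (real n - real k * exp x)" for x
  have [measurable]: "h \<in> borel_measurable borel"
    unfolding h_def by measurable
  have int_h: "integrable lborel h"
    unfolding h_def using k(1) abs_stein_factor_le by (intro integrable_order_density[where L = "real n + real k"]) auto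
  \<comment> \<open>The indicator expresses u <= x through the difference, which gives joint
    measurability.\<close>
  define f where "f u x = \<beta> u * (indicator {..0} (u - x) * h x)" for u x
  have int_f: "integrable (lborel \<Otimes>\<^sub>M lborel) (case_prod f)"
  proof (rule lborel_pair.Fubini_integrable)
    show [measurable]: "case_prod f \<in> borel_measurable (lborel \<Otimes>\<^sub>M lborel)"
      unfolding f_def by measurable
    have inth: "integrable lborel (\<lambda>x. indicator {..0} (u - x) * h x)" for u
      by (rule Bochner_Integration.integrable_bound[OF int_h]) (auto split: split_indicator)
    then show "AE u in lborel. integrable lborel (\<lambda>x. case_prod f (u, x))"
      by (simp add: f_def)
    show "integrable lborel (\<lambda>u. \<integral>x. norm (case_prod f (u, x)) \<partial>lborel)"
    proof (rule Bochner_Integration.integrable_bound)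
      show "integrable lborel (\<lambda>u. \<beta> u * (\<integral>x. \<bar>h x\<bar> \<partial>lborel))"
        using integrable_\<beta> by simp
      show "AE u in lborel. norm (\<integral>x. norm (case_prod f (u, x)) \<partial>lborel) \<le> norm (\<beta> u * (\<integral>x. \<bar>h x\<bar> \<partial>lborel))"
      proof (rule always_eventually, rule allI)
        fix u
        have "(\<integral>x. norm (case_prod f (u, x)) \<partial>lborel) = \<beta> u * (\<integral>x. \<bar>indicator {..0} (u - x) * h x\<bar> \<partial>lborel)"
          by (simp add: f_def abs_mult \<beta>_nonneg)
        also have "\<dots> \<le> \<beta> u * (\<integral>x. \<bar>h x\<bar> \<partial>lborel)"
          using inth int_h by (intro mult_left_mono integral_mono) (auto simp: \<beta>_nonneg split: split_indicator)
        finally have "(\<integral>x. norm (case_prod f (u, x)) \<partial>lborel) \<le> \<beta> u * (\<integral>x. \<bar>h x\<bar> \<partial>lborel)" .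
        moreover have "0 \<le> (\<integral>x. norm (case_prod f (u, x)) \<partial>lborel)"
          by (rule Bochner_Integration.integral_nonneg) simp
        ultimately show "norm (\<integral>x. norm (case_prod f (u, x)) \<partial>lborel) \<le> norm (\<beta> u * (\<integral>x. \<bar>h x\<bar> \<partial>lborel))"
          by simp
      qed
    qed measurable
  qed
  have "(\<integral>x. order_density n k x * ((real n - real k * exp x) * Q x) \<partial>lborel) = (\<integral>x. (\<integral>u. f u x \<partial>lborel) \<partial>lborel)"
  proof (rule Bochner_Integration.integral_cong[OF refl])
    fix x
    have "(\<integral>u. f u x \<partial>lborel) = (\<integral>u. h x * (indicator {..x} u * \<beta> u) \<partial>lborel)"
      unfolding f_def by (intro Bochner_Integration.integral_cong) (auto split: split_indicator)
    also have "\<dots> = h x * Q x"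
      by (simp add: Q_eq)
    finally show "order_density n k x * ((real n - real k * exp x) * Q x) = (\<integral>u. f u x \<partial>lborel)"
      by (simp add: h_def)
  qed
  also have "\<dots> = (\<integral>u. (\<integral>x. f u x \<partial>lborel) \<partial>lborel)"
    using int_f by (rule lborel_pair.Fubini_integral)
  also have "\<dots> = (\<integral>u. - (order_stein n k u * \<beta> u) \<partial>lborel)"
  proof (rule Bochner_Integration.integral_cong[OF refl])
    fix u
    show "(\<integral>x. f u x \<partial>lborel) = - (order_stein n k u * \<beta> u)"
    proof (cases "0 \<le> u")
      case True
      have "(\<integral>x. f u x \<partial>lborel) = \<beta> u * (\<integral>x. indicator {..0} (u - x) * h x \<partial>lborel)"
        by (simp add: f_def)
      also have "(\<integral>x. indicator {..0} (u - x) * h x \<partial>lborel) = (LBINT x:{u<..}. h x)"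
        unfolding set_lebesgue_integral_def
        \<comment> \<open>The closed and the open half-line differ by the null set containing
          \<open>u\<close> alone.\<close>
        using AE_lborel_singleton[of u]
        by (intro integral_cong_AE) (auto elim!: eventually_mono split: split_indicator)
      also have "\<dots> = - order_stein n k u"
        unfolding h_def using k True by (rule integral_order_stein)
      finally show ?thesis by simp
    qed (simp add: f_def \<beta>_def)
  qed
  finally show ?thesis by simp
qed

lemma abs_m_le_K: "\<bar>m y\<bar> \<le> K"
  using abs_m_le[of y] b_le_K[of y] by linarith

lemma
  assumes "k < n"
  shows integrable_m: "integrable (order_law n k) m"
    and integrable_m_square: "integrable (order_law n k) (\<lambda>x. (m x)\<^sup>2)"
    and integrable_b: "integrable (order_law n k) b"
    and integrable_b_square: "integrable (order_law n k) (\<lambda>x. (b x)\<^sup>2)"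
proof -
  interpret L: prob_space "order_law n k"
    using assms by (rule prob_space_order_law)
  show "integrable (order_law n k) m"
    by (rule L.integrable_const_bound[where B = K]) (auto simp: abs_m_le_K)
  show "integrable (order_law n k) (\<lambda>x. (m x)\<^sup>2)"
    by (rule L.integrable_const_bound[where B = "K\<^sup>2"])
      (auto intro!: power_mono[of "\<bar>m _\<bar>" K 2, simplified] abs_m_le_K)
  show "integrable (order_law n k) b"
    by (rule L.integrable_const_bound[where B = K]) (auto simp: b_nonneg b_le_K)
  show "integrable (order_law n k) (\<lambda>x. (b x)\<^sup>2)"
    by (rule L.integrable_const_bound[where B = "K\<^sup>2"]) (auto intro!: power_mono b_le_K b_nonneg)
qed

text \<open>The Poincare inequality for the law of \<open>Y\<^sub>(\<^sub>k\<^sub>+\<^sub>1\<^sub>)\<close>, with constant \<open>1 / k\<close>. As \<open>\<zeta>\<close> is only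
  measurable, \<open>m\<close> need not be differentiable; \<open>2 b\<close> stands in for a bound on its derivative.\<close>

lemma variance_m_le:
  assumes k: "1 \<le> k" "k < n"
  shows "prob_space.variance (order_law n k) m \<le> 4 / real k * (\<integral>x. (b x)\<^sup>2 \<partial>order_law n k)"
proof -
  interpret L: prob_space "order_law n k"
    using k(2) by (rule prob_space_order_law)
  \<comment> \<open>With this choice \<open>exp a\<close> is the mean of \<open>exp\<close> under
    the order law, and it is at least 1 because \<open>k < n\<close>.\<close>
  define a where "a = ln (real n / real k)"
  have a: "0 \<le> a" "exp a = real n / real k"
    using k by (simp_all add: a_def)
  note int_m = integrable_m[OF k(2)] integrable_m_square[OF k(2)]
  note int_b2 = integrable_b_square[OF k(2)]
  have int_e: "integrable (order_law n k) (\<lambda>x. (real n - real k * exp x) * f x)"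
    if [measurable]: "f \<in> borel_measurable borel" and "\<And>x. \<bar>f x\<bar> \<le> B" for f B
  proof (rule integrable_order_law[OF k(1), where L = "(real n + real k) * B"])
    show "\<bar>(real n - real k * exp x) * f x\<bar> \<le> (real n + real k) * B * exp x" if "0 < x" for x
    proof -
      have "\<bar>real n - real k * exp x\<bar> * \<bar>f x\<bar> \<le> ((real n + real k) * exp x) * B"
        using abs_stein_factor_le[OF that] \<open>\<And>x. \<bar>f x\<bar> \<le> B\<close> by (intro mult_mono) auto
      then show ?thesis by (simp add: abs_mult mult_ac)
    qed
  qed measurable
  have mean_e: "(\<integral>x. (real n - real k * exp x) * c \<partial>order_law n k) = 0" for c
  proof -
    have "(\<integral>x. real n - real k * exp x \<partial>order_law n k) = (\<integral>x. order_density n k x * (real n - real k * exp x) \<partial>lborel)"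
      by (rule integral_order_law) measurable
    also have "\<dots> = (LBINT x:{0<..}. order_density n k x * (real n - real k * exp x))"
      unfolding set_lebesgue_integral_def
      by (intro Bochner_Integration.integral_cong) (auto simp: order_density_def split: split_indicator)
    also have "\<dots> = 0"
      using integral_order_stein[OF k, of 0] k by (simp add: order_stein_def)
    finally show ?thesis by simp
  qed
  \<comment> \<open>Replacing the mean of \<open>m\<close> by any other centre only increases the
    second moment.\<close>
  have "L.variance m \<le> (\<integral>x. (m x - m a)\<^sup>2 \<partial>order_law n k)"
  proof -
    have "(\<integral>x. (m x - m a)\<^sup>2 \<partial>order_law n k) = L.variance m + (L.expectation m - m a)\<^sup>2"
      using int_m L.prob_space
      by (simp add: L.variance_eq power2_diff) (simp add: power2_eq_square algebra_simps)
    then show ?thesis by simp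
  qed
  also have "\<dots> \<le> (\<integral>x. 4 / real k * ((real n - real k * exp x) * (Q a - Q x)) \<partial>order_law n k)"
  proof (rule integral_mono_AE)
    show "integrable (order_law n k) (\<lambda>x. (m x - m a)\<^sup>2)"
      unfolding power2_diff using int_m by simp
    have "\<bar>Q a - Q x\<bar> \<le> 2 * (\<integral>u. \<beta> u \<partial>lborel)" for x
      using abs_Q_le[of a] abs_Q_le[of x] by linarith
    then show "integrable (order_law n k) (\<lambda>x. 4 / real k * ((real n - real k * exp x) * (Q a - Q x)))"
      by (intro integrable_mult_right int_e) auto
    show "AE x in order_law n k. (m x - m a)\<^sup>2 \<le> 4 / real k * ((real n - real k * exp x) * (Q a - Q x))"
      using AE_order_law_pos
    proof eventually_elim
      case (elim x)
      have "(m x - m a)\<^sup>2 \<le> 4 * ((exp x - exp a) * (Q x - Q a))"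
        using m_diff_square_le[of a x] a(1) elim by simp
      \<comment> \<open>Both differences are reversed and 1 / k is pulled out, so that the factor n
        - k exp x appears; it has mean zero, and the constant \<open>Q a\<close> will drop
        out.\<close>
      also have "\<dots> = 4 / real k * ((real n - real k * exp x) * (Q a - Q x))"
        unfolding a(2) using k by (simp add: field_simps)
      finally show ?case .
    qed
  qed
  also have "\<dots> = 4 / real k * (- (\<integral>x. (real n - real k * exp x) * Q x \<partial>order_law n k))"
  proof -
    have "(\<integral>x. (real n - real k * exp x) * (Q a - Q x) \<partial>order_law n k)
        = (\<integral>x. (real n - real k * exp x) * Q a - (real n - real k * exp x) * Q x \<partial>order_law n k)"
      by (simp add: right_diff_distrib)
    also have "\<dots> = (\<integral>x. (real n - real k * exp x) * Q a \<partial>order_law n k) - (\<integral>x. (real n - real k * exp x) * Q x \<partial>order_law n k)"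
      by (intro Bochner_Integration.integral_diff int_e[of "\<lambda>_. Q a"] int_e[of Q])
        (auto intro: abs_Q_le)
    finally show ?thesis
      unfolding mean_e by (simp del: times_divide_eq_left)
  qed
  also have "- (\<integral>x. (real n - real k * exp x) * Q x \<partial>order_law n k) = (\<integral>u. order_stein n k u * \<beta> u \<partial>lborel)"
    by (subst integral_order_law) (simp_all add: integral_stein_Q[OF k])
  also have "\<dots> \<le> (\<integral>x. (b x)\<^sup>2 \<partial>order_law n k)"
  proof -
    \<comment> \<open>The weight exp(-u) in \<open>\<beta>\<close> cancels the growth of exp u - 1
      and leaves the factor 1 - exp(-u), which is at most 1.\<close>
    have le: "order_stein n k u * \<beta> u \<le> order_density n k u * (b u)\<^sup>2" "0 \<le> order_stein n k u * \<beta> u" for u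
    proof -
      have "order_stein n k u * \<beta> u \<le> order_density n k u * (b u)\<^sup>2 \<and> 0 \<le> order_stein n k u * \<beta> u"
      proof (cases "0 < u")
        case True
        have "order_stein n k u * \<beta> u = order_density n k u * (b u)\<^sup>2 * (1 - exp (- u))"
          using True by (simp add: order_stein_eq[OF k(2)] \<beta>_def algebra_simps flip: exp_add)
        moreover have "order_density n k u * (b u)\<^sup>2 * (1 - exp (- u)) \<le> order_density n k u * (b u)\<^sup>2 * 1"
          by (intro mult_left_mono) (auto simp: order_density_nonneg)
        ultimately show ?thesis
          using True by (auto simp: order_density_nonneg)
      next
        case False
        then show ?thesis
          using k by (cases "u = 0") (auto simp: order_stein_def \<beta>_def order_density_nonneg power_0_left)
      qed
      then show "order_stein n k u * \<beta> u \<le> order_density n k u * (b u)\<^sup>2" "0 \<le> order_stein n k u * \<beta> u"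
        by auto
    qed
    have "integrable lborel (\<lambda>u. order_density n k u * (b u)\<^sup>2)"
      using int_b2 by (subst (asm) integrable_density) (auto simp: order_density_nonneg)
    moreover from this have "integrable lborel (\<lambda>u. order_stein n k u * \<beta> u)"
      by (rule Bochner_Integration.integrable_bound)
        (use le in \<open>auto simp: order_stein_def[abs_def] intro!: always_eventually order.trans[OF _ abs_ge_self]\<close>)
    ultimately have "(\<integral>u. order_stein n k u * \<beta> u \<partial>lborel) \<le> (\<integral>u. order_density n k u * (b u)\<^sup>2 \<partial>lborel)"
      using le(1) by (intro integral_mono)
    then show ?thesis
      by (subst integral_order_law) simp_all
  qed
  finally show ?thesis
    using k by (simp add: divide_right_mono mult_left_mono)
qed

end

section \<open>Variance of the Hill estimator\<close>

abbreviation exp_sample :: "nat \<Rightarrow> (nat \<Rightarrow> real) measure" where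
  "exp_sample n \<equiv> Pi\<^sub>M {..<n} (\<lambda>_. std_exp)"

abbreviation exp_order_stat :: "nat \<Rightarrow> nat \<Rightarrow> (nat \<Rightarrow> real) \<Rightarrow> real" where
  "exp_order_stat n \<equiv> order_stat n (\<lambda>i x. x i)"

lemma prob_space_exp_sample: "prob_space (exp_sample n)"
  by (intro prob_space_PiM prob_space_std_exp)

lemma measurable_exp_order_stat [measurable]:
  "1 \<le> j \<Longrightarrow> j \<le> n \<Longrightarrow> exp_order_stat n j \<in> borel_measurable (exp_sample n)"
  by (intro measurable_order_stat) simp_all

lemma distr_exp_order_stat:
  assumes "k < n"
  shows "distr (exp_sample n) borel (exp_order_stat n (k + 1)) = order_law n k"
proof (rule measure_eqI)
  fix A assume "A \<in> sets (distr (exp_sample n) borel (exp_order_stat n (k + 1)))"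
  then have [measurable]: "A \<in> sets borel" by simp
  have [measurable]: "exp_order_stat n (k + 1) \<in> borel_measurable (exp_sample n)"
    using assms by (intro measurable_exp_order_stat) auto
  have prob: "prob_space (Pi\<^sub>M S (\<lambda>_. std_exp))" for S :: "nat set"
    by (intro prob_space_PiM prob_space_std_exp)
  have "emeasure (distr (exp_sample n) borel (exp_order_stat n (k + 1))) A
      = (\<integral>\<^sup>+t. indicator A t \<partial>distr (exp_sample n) borel (exp_order_stat n (k + 1)))"
    by simp
  also have "\<dots> = (\<integral>\<^sup>+x. indicator A (exp_order_stat n (k + 1) x) \<partial>exp_sample n)"
    by (rule nn_integral_distr) measurable
  also have "\<dots> = (\<integral>\<^sup>+t. ennreal (order_density n k t) * indicator A t \<partial>lborel)"
    using nn_integral_order_stats[OF assms, of "\<lambda>t _. indicator A t" "\<lambda>_ _. 0" "indicator A"] prob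
    by (simp add: prob_space.emeasure_space_1)
  also have "\<dots> = emeasure (order_law n k) A"
    by (simp add: emeasure_density)
  finally show "emeasure (distr (exp_sample n) borel (exp_order_stat n (k + 1))) A = emeasure (order_law n k) A" .
qed simp

section \<open>Moments of the sum of log-excesses\<close>

context bounded_rate
begin

text \<open>This is \<open>k\<close> times the Hill estimator of a sample whose log-quantile at
  \<open>y\<close> is a constant plus \<open>\<gamma> * y + G y\<close>; the constant cancels in the
  ratios.\<close>

definition excess :: "real \<Rightarrow> nat \<Rightarrow> nat \<Rightarrow> (nat \<Rightarrow> real) \<Rightarrow> real" where
  "excess \<gamma> n k x = (\<Sum>l=1..k. \<gamma> * (exp_order_stat n l x - exp_order_stat n (k + 1) x)
     + (G (exp_order_stat n l x) - G (exp_order_stat n (k + 1) x)))"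

definition increment_var :: "real \<Rightarrow> real \<Rightarrow> real" where
  "increment_var \<gamma> t = prob_space.variance std_exp (\<lambda>z. \<gamma> * z + (G (t + z) - G t))"

lemma measurable_excess [measurable]:
  assumes "k < n"
  shows "excess \<gamma> n k \<in> borel_measurable (exp_sample n)"
proof -
  have [measurable]: "exp_order_stat n (k + 1) \<in> borel_measurable (exp_sample n)"
    using assms by (intro measurable_exp_order_stat) auto
  have [measurable]: "exp_order_stat n l \<in> borel_measurable (exp_sample n)" if "l \<in> {1..k}" for l
    using assms that by (intro measurable_exp_order_stat) auto
  show ?thesis
    unfolding excess_def[abs_def] by measurable
qed

lemma measurable_increment_var [measurable]: "increment_var \<gamma> \<in> borel_measurable borel"
proof -
  interpret prob_space std_exp by (rule prob_space_std_exp)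
  show ?thesis unfolding increment_var_def[abs_def] by measurable
qed

lemma increment_var_bounds:
  assumes "0 \<le> \<gamma>"
  shows "\<gamma>\<^sup>2 - 2 * \<gamma> * b t \<le> increment_var \<gamma> t" "increment_var \<gamma> t \<le> \<gamma>\<^sup>2 + 2 * \<gamma> * b t + (b t)\<^sup>2"
    "0 \<le> increment_var \<gamma> t"
  using increment_variance(2,3)[OF assms, of t] prob_space.variance_positive[OF prob_space_std_exp]
  by (simp_all add: increment_var_def)

lemma abs_increment_var_le:
  assumes "0 \<le> \<gamma>"
  shows "\<bar>increment_var \<gamma> t\<bar> \<le> \<gamma>\<^sup>2 + 2 * \<gamma> * K + K\<^sup>2"
proof -
  have "\<gamma>\<^sup>2 + 2 * \<gamma> * b t + (b t)\<^sup>2 \<le> \<gamma>\<^sup>2 + 2 * \<gamma> * K + K\<^sup>2"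
    using assms b_le_K[of t] b_nonneg[of t] by (intro add_mono mult_left_mono power_mono) auto
  then show ?thesis
    using increment_var_bounds[OF assms, of t] by simp
qed

lemma integrable_increment_var:
  assumes "k < n" "0 \<le> \<gamma>"
  shows "integrable (order_law n k) (increment_var \<gamma>)"
proof -
  interpret L: prob_space "order_law n k"
    using assms(1) by (rule prob_space_order_law)
  show ?thesis
    by (rule L.integrable_const_bound[where B = "\<gamma>\<^sup>2 + 2 * \<gamma> * K + K\<^sup>2"])
      (auto simp: abs_increment_var_le[OF assms(2)])
qed

text \<open>\<open>nn_integral_order_stats\<close> speaks of nonnegative functions only, so the mean
  of \<open>excess\<close> is reached through second moments about different points.
  \<open>J c t\<close> is the conditional second moment given the value \<open>t\<close> of the
  order statistic: variance of a sum of \<open>k\<close> independent terms plus squared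
  mean.\<close>

lemma excess_shifted_square:
  assumes "k < n" "0 \<le> \<gamma>"
  defines "J \<equiv> \<lambda>c t. real k * increment_var \<gamma> t + (real k * (\<gamma> + m t) + c)\<^sup>2"
  shows "integrable (exp_sample n) (\<lambda>x. (excess \<gamma> n k x + c)\<^sup>2)"
    and "(\<integral>x. (excess \<gamma> n k x + c)\<^sup>2 \<partial>exp_sample n) = (\<integral>t. J c t \<partial>order_law n k)"
    and "integrable (order_law n k) (J c)"
proof -
  interpret L: prob_space "order_law n k"
    using assms(1) by (rule prob_space_order_law)
  have [measurable]: "J c \<in> borel_measurable borel"
    unfolding J_def by measurable
  have J_nonneg: "0 \<le> J c t" for t
    using increment_var_bounds(3)[OF assms(2)] by (simp add: J_def)
  show int_J: "integrable (order_law n k) (J c)"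
  proof (rule L.integrable_const_bound[where B = "real k * (\<gamma>\<^sup>2 + 2 * \<gamma> * K + K\<^sup>2) + (real k * (\<gamma> + K) + \<bar>c\<bar>)\<^sup>2"])
    have "\<bar>J c t\<bar> \<le> real k * (\<gamma>\<^sup>2 + 2 * \<gamma> * K + K\<^sup>2) + (real k * (\<gamma> + K) + \<bar>c\<bar>)\<^sup>2" for t
    proof -
      have "\<bar>real k * (\<gamma> + m t) + c\<bar> \<le> \<bar>real k * (\<gamma> + m t)\<bar> + \<bar>c\<bar>"
        by (rule abs_triangle_ineq)
      also have "\<dots> \<le> real k * (\<gamma> + K) + \<bar>c\<bar>"
        using abs_m_le_K[of t] assms(2) by (auto simp: abs_mult intro!: mult_left_mono)
      finally have "(real k * (\<gamma> + m t) + c)\<^sup>2 \<le> (real k * (\<gamma> + K) + \<bar>c\<bar>)\<^sup>2"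
        by (metis abs_ge_zero power2_abs power_mono)
      moreover have "real k * increment_var \<gamma> t \<le> real k * (\<gamma>\<^sup>2 + 2 * \<gamma> * K + K\<^sup>2)"
        using abs_increment_var_le[OF assms(2), of t] by (intro mult_left_mono) auto
      ultimately show ?thesis
        using J_nonneg[of t] by (simp add: J_def)
    qed
    then show "AE t in order_law n k. norm (J c t) \<le> real k * (\<gamma>\<^sup>2 + 2 * \<gamma> * K + K\<^sup>2) + (real k * (\<gamma> + K) + \<bar>c\<bar>)\<^sup>2"
      by simp
  qed simp
  have [measurable]: "excess \<gamma> n k \<in> borel_measurable (exp_sample n)"
    using assms(1) by (rule measurable_excess)
  define d where "d t s = \<gamma> * (s - t) + (G s - G t)" for t s
  have inner: "(\<integral>\<^sup>+z. ennreal (((\<Sum>j\<in>S. d t (t + z j)) + c)\<^sup>2) \<partial>Pi\<^sub>M S (\<lambda>_. std_exp)) = ennreal (J c t)"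
    if S: "finite S" "card S = k" for S :: "nat set" and t
  proof -
    interpret S: prob_space "Pi\<^sub>M S (\<lambda>_. std_exp)"
      by (intro prob_space_PiM prob_space_std_exp)
    let ?g = "\<lambda>z. \<gamma> * z + (G (t + z) - G t)"
    let ?W = "\<lambda>z. \<Sum>j\<in>S. ?g (z j)"
    have g: "?g \<in> borel_measurable std_exp" by measurable
    note mom = integrable_PiM_sum[OF prob_space_std_exp S(1) g increment_variance(1)[OF assms(2)]]
      integrable_PiM_sum_square[OF prob_space_std_exp S(1) g increment_variance(1)[OF assms(2)]]
      integral_PiM_sum[OF prob_space_std_exp S(1) g increment_variance(1)[OF assms(2)]]
      integral_PiM_sum_square[OF prob_space_std_exp S(1) g increment_variance(1)[OF assms(2)]]
    have sq: "(?W z + c)\<^sup>2 = (?W z)\<^sup>2 + 2 * c * ?W z + c\<^sup>2" for z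
      by (simp add: power2_sum)
    have int: "integrable (Pi\<^sub>M S (\<lambda>_. std_exp)) (\<lambda>z. (?W z + c)\<^sup>2)"
      unfolding sq using mom(1,2) by (intro Bochner_Integration.integrable_add integrable_mult_right) simp_all
    have "(\<integral>z. (?W z + c)\<^sup>2 \<partial>Pi\<^sub>M S (\<lambda>_. std_exp))
        = (\<integral>z. (?W z)\<^sup>2 \<partial>Pi\<^sub>M S (\<lambda>_. std_exp)) + 2 * c * (\<integral>z. ?W z \<partial>Pi\<^sub>M S (\<lambda>_. std_exp)) + c\<^sup>2"
    proof -
      have "(\<integral>z. (?W z)\<^sup>2 + 2 * c * ?W z + c\<^sup>2 \<partial>Pi\<^sub>M S (\<lambda>_. std_exp))
          = (\<integral>z. (?W z)\<^sup>2 + 2 * c * ?W z \<partial>Pi\<^sub>M S (\<lambda>_. std_exp)) + (\<integral>z. c\<^sup>2 \<partial>Pi\<^sub>M S (\<lambda>_. std_exp))"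
        using mom(1,2) by (intro Bochner_Integration.integral_add Bochner_Integration.integrable_add integrable_mult_right) simp_all
      also have "(\<integral>z. (?W z)\<^sup>2 + 2 * c * ?W z \<partial>Pi\<^sub>M S (\<lambda>_. std_exp))
          = (\<integral>z. (?W z)\<^sup>2 \<partial>Pi\<^sub>M S (\<lambda>_. std_exp)) + (\<integral>z. 2 * c * ?W z \<partial>Pi\<^sub>M S (\<lambda>_. std_exp))"
        using mom(1,2) by (intro Bochner_Integration.integral_add integrable_mult_right)
      finally show ?thesis
        unfolding sq using S.prob_space by simp
    qed
    also have "\<dots> = J c t"
      unfolding mom(3,4) S(2) increment_var_def[symmetric] unfolding increment_variance(4)[OF assms(2)]
      by (simp add: J_def power2_sum algebra_simps)
    finally have "(\<integral>\<^sup>+z. ennreal ((?W z + c)\<^sup>2) \<partial>Pi\<^sub>M S (\<lambda>_. std_exp)) = ennreal (J c t)"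
      using nn_integral_eq_integral[OF int] by simp
    then show ?thesis by (simp add: d_def)
  qed
  have "(\<integral>\<^sup>+x. ennreal ((excess \<gamma> n k x + c)\<^sup>2) \<partial>exp_sample n) = (\<integral>\<^sup>+t. ennreal (order_density n k t) * ennreal (J c t) \<partial>lborel)"
    unfolding excess_def d_def[symmetric]
    using assms(1) inner by (intro nn_integral_order_stats[of k n "\<lambda>t w. ennreal ((w + c)\<^sup>2)"]) (auto simp: d_def)
  also have "\<dots> = (\<integral>\<^sup>+t. ennreal (J c t) \<partial>order_law n k)"
    by (simp add: nn_integral_order_law)
  also have "\<dots> = ennreal (\<integral>t. J c t \<partial>order_law n k)"
    using int_J J_nonneg by (intro nn_integral_eq_integral) auto
  finally have nn: "(\<integral>\<^sup>+x. ennreal ((excess \<gamma> n k x + c)\<^sup>2) \<partial>exp_sample n) = ennreal (\<integral>t. J c t \<partial>order_law n k)" .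
  have nonneg: "0 \<le> (\<integral>t. J c t \<partial>order_law n k)"
    using J_nonneg by (intro Bochner_Integration.integral_nonneg)
  show "integrable (exp_sample n) (\<lambda>x. (excess \<gamma> n k x + c)\<^sup>2)"
    using nn by (intro integrableI_nonneg) auto
  show "(\<integral>x. (excess \<gamma> n k x + c)\<^sup>2 \<partial>exp_sample n) = (\<integral>t. J c t \<partial>order_law n k)"
    using nn nonneg by (intro integral_eq_nn_integral[THEN trans]) auto
qed

text \<open>The law of total variance: the mean of the conditional variance plus the variance of the
  conditional mean k (\<gamma> + m), in which the constant \<gamma> drops out.\<close>

lemma excess_moments:
  assumes "k < n" "0 \<le> \<gamma>"
  shows "integrable (exp_sample n) (excess \<gamma> n k)"
    and "integrable (exp_sample n) (\<lambda>x. (excess \<gamma> n k x)\<^sup>2)"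
    and "prob_space.variance (exp_sample n) (excess \<gamma> n k)
      = real k * (\<integral>t. increment_var \<gamma> t \<partial>order_law n k) + (real k)\<^sup>2 * prob_space.variance (order_law n k) m"
proof -
  interpret P: prob_space "exp_sample n" by (rule prob_space_exp_sample)
  interpret L: prob_space "order_law n k"
    using assms(1) by (rule prob_space_order_law)
  note sq = excess_shifted_square[OF assms, of 0, simplified]
  have [measurable]: "excess \<gamma> n k \<in> borel_measurable (exp_sample n)"
    using assms(1) by (rule measurable_excess)
  show int2: "integrable (exp_sample n) (\<lambda>x. (excess \<gamma> n k x)\<^sup>2)" by (rule sq(1))
  show int1: "integrable (exp_sample n) (excess \<gamma> n k)"
    using int2 by (rule P.square_integrable_imp_integrable[rotated]) simp
  note int_m = integrable_m[OF assms(1)] and int_m2 = integrable_m_square[OF assms(1)]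
  have int_v: "integrable (order_law n k) (increment_var \<gamma>)"
    using assms by (rule integrable_increment_var)
  define I where "I = L.expectation m"
  define I2 where "I2 = L.expectation (\<lambda>t. (m t)\<^sup>2)"
  define v where "v = L.expectation (increment_var \<gamma>)"
  have J: "(\<integral>x. (excess \<gamma> n k x + c)\<^sup>2 \<partial>exp_sample n)
      = real k * v + (real k)\<^sup>2 * (\<gamma>\<^sup>2 + 2 * \<gamma> * I + I2) + 2 * c * real k * (\<gamma> + I) + c\<^sup>2" for c
  proof -
    have e: "real k * increment_var \<gamma> t + (real k * (\<gamma> + m t) + c)\<^sup>2
      = real k * increment_var \<gamma> t + (real k)\<^sup>2 * (m t)\<^sup>2 + (2 * (real k)\<^sup>2 * \<gamma> + 2 * c * real k) * m t
        + ((real k)\<^sup>2 * \<gamma>\<^sup>2 + 2 * c * real k * \<gamma> + c\<^sup>2)" for t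
      by (simp add: power2_eq_square algebra_simps)
    show ?thesis
      unfolding excess_shifted_square(2)[OF assms] e using int_m int_m2 int_v L.prob_space
      by (simp add: I_def I2_def v_def) (simp add: algebra_simps)
  qed
  \<comment> \<open>Comparing the shifts 1 and 0 isolates the first moment.\<close>
  have "P.expectation (\<lambda>x. (excess \<gamma> n k x + 1)\<^sup>2) = P.expectation (\<lambda>x. (excess \<gamma> n k x)\<^sup>2) + 2 * P.expectation (excess \<gamma> n k) + 1"
    unfolding power2_sum using int1 int2 P.prob_space by simp
  then have "P.expectation (excess \<gamma> n k) = real k * (\<gamma> + I)"
    using J[of 1] J[of 0] by simp
  moreover have "P.expectation (\<lambda>x. (excess \<gamma> n k x)\<^sup>2) = real k * v + (real k)\<^sup>2 * (\<gamma>\<^sup>2 + 2 * \<gamma> * I + I2)"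
    using J[of 0] by simp
  ultimately have "P.expectation (\<lambda>x. (excess \<gamma> n k x)\<^sup>2) - (P.expectation (excess \<gamma> n k))\<^sup>2
      = real k * v + (real k)\<^sup>2 * (I2 - I\<^sup>2)"
    by (simp only:) (simp add: power2_eq_square algebra_simps)
  moreover have "P.variance (excess \<gamma> n k) = P.expectation (\<lambda>x. (excess \<gamma> n k x)\<^sup>2) - (P.expectation (excess \<gamma> n k))\<^sup>2"
    using int1 int2 by (rule P.variance_eq)
  moreover have "L.variance m = I2 - I\<^sup>2"
    using int_m int_m2 by (simp add: L.variance_eq I_def I2_def)
  ultimately show "P.variance (excess \<gamma> n k) = real k * L.expectation (increment_var \<gamma>) + (real k)\<^sup>2 * L.variance m"
    unfolding v_def by metis
qed

lemma variance_excess_bounds: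
  assumes "1 \<le> k" "k < n" "0 \<le> \<gamma>"
  shows "- (2 * \<gamma> / real k) * (\<integral>t. b t \<partial>order_law n k)
      \<le> prob_space.variance (exp_sample n) (\<lambda>x. excess \<gamma> n k x / real k) - \<gamma>\<^sup>2 / real k"
    and "prob_space.variance (exp_sample n) (\<lambda>x. excess \<gamma> n k x / real k) - \<gamma>\<^sup>2 / real k
      \<le> 2 * \<gamma> / real k * (\<integral>t. b t \<partial>order_law n k) + 5 / real k * (\<integral>t. (b t)\<^sup>2 \<partial>order_law n k)"
proof -
  interpret P: prob_space "exp_sample n" by (rule prob_space_exp_sample)
  interpret L: prob_space "order_law n k"
    using assms(2) by (rule prob_space_order_law)
  define V where "V = L.expectation (increment_var \<gamma>)"
  define B where "B = L.expectation b"
  define B2 where "B2 = L.expectation (\<lambda>t. (b t)\<^sup>2)"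
  have k: "0 < real k" using assms(1) by simp
  have int_v: "integrable (order_law n k) (increment_var \<gamma>)"
    using assms(2,3) by (rule integrable_increment_var)
  note int_b = integrable_b[OF assms(2)] and int_b2 = integrable_b_square[OF assms(2)]
  have "L.expectation (\<lambda>t. \<gamma>\<^sup>2 - 2 * \<gamma> * b t) \<le> V"
    unfolding V_def using increment_var_bounds(1)[OF assms(3)] int_b int_v by (intro integral_mono) auto
  then have V_lower: "\<gamma>\<^sup>2 - 2 * \<gamma> * B \<le> V"
    using int_b L.prob_space by (simp add: B_def)
  have "V \<le> L.expectation (\<lambda>t. \<gamma>\<^sup>2 + 2 * \<gamma> * b t + (b t)\<^sup>2)"
    unfolding V_def using increment_var_bounds(2)[OF assms(3)] int_b int_b2 int_v by (intro integral_mono) auto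
  then have V_upper: "V \<le> \<gamma>\<^sup>2 + 2 * \<gamma> * B + B2"
    using int_b int_b2 L.prob_space by (simp add: B_def B2_def)
  have "P.variance (\<lambda>x. excess \<gamma> n k x / real k) = P.variance (excess \<gamma> n k) / (real k)\<^sup>2"
    by (simp add: power_divide flip: diff_divide_distrib)
  also have "\<dots> = V / real k + L.variance m"
    unfolding excess_moments(3)[OF assms(2,3)] using k by (simp add: V_def field_simps power2_eq_square)
  finally have var: "P.variance (\<lambda>x. excess \<gamma> n k x / real k) = V / real k + L.variance m" .
  have "(\<gamma>\<^sup>2 - 2 * \<gamma> * B) / real k \<le> V / real k"
    using V_lower k by (intro divide_right_mono) auto
  then have "- (2 * \<gamma> / real k) * B \<le> V / real k - \<gamma>\<^sup>2 / real k"
    by (simp add: diff_divide_distrib)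
  then show "- (2 * \<gamma> / real k) * L.expectation b \<le> P.variance (\<lambda>x. excess \<gamma> n k x / real k) - \<gamma>\<^sup>2 / real k"
    unfolding var B_def[symmetric] using L.variance_positive[of m] by linarith
  have "V / real k \<le> (\<gamma>\<^sup>2 + 2 * \<gamma> * B + B2) / real k"
    using V_upper k by (intro divide_right_mono) auto
  \<comment> \<open>The constant 5 is the sum of 4 from here and 1 from the conditional
    variance.\<close>
  moreover have "L.variance m \<le> 4 / real k * B2"
    using variance_m_le[OF assms(1,2)] by (simp add: B2_def)
  ultimately show "P.variance (\<lambda>x. excess \<gamma> n k x / real k) - \<gamma>\<^sup>2 / real k
      \<le> 2 * \<gamma> / real k * L.expectation b + 5 / real k * L.expectation (\<lambda>t. (b t)\<^sup>2)"
    unfolding var B_def[symmetric] B2_def[symmetric] by (simp add: add_divide_distrib)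
qed

end

section \<open>Reduction of the sample to exponential variables\<close>

lemma von_mises_log_quantile:
  assumes "von_mises F \<gamma> \<eta>"
  defines "\<zeta> \<equiv> \<lambda>u. if 0 < u then \<eta> (exp u) else 0"
  shows "\<zeta> \<in> borel_measurable borel"
    and "\<exists>c>0. \<forall>y>0. tail_quantile F (exp y) = c * exp (\<gamma> * y + (LBINT u:{0..y}. \<zeta> u))"
proof -
  \<comment> \<open>Extending \<eta> by 0 outside its domain makes it Borel measurable on the whole
    line.\<close>
  define \<eta>' where "\<eta>' s = (if s \<in> {1<..} then \<eta> s else 0)" for s :: real
  have "\<eta> \<in> borel_measurable (restrict_space borel {1<..})"
    using assms(1) by (simp add: von_mises_def)
  then have \<eta>' [measurable]: "\<eta>' \<in> borel_measurable borel"
    unfolding \<eta>'_def by (subst (asm) measurable_restrict_space_iff[where c = 0]) auto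
  have \<zeta>: "\<zeta> u = \<eta>' (exp u)" for u
    by (simp add: \<zeta>_def \<eta>'_def)
  show "\<zeta> \<in> borel_measurable borel"
    unfolding \<zeta> by measurable
  obtain c where c: "c > 0" "\<And>t. 1 < t \<Longrightarrow> tail_quantile F t = c * t powr \<gamma> * exp (LBINT s:{1<..t}. \<eta> s / s)"
    using assms(1) by (auto simp: von_mises_def)
  have "tail_quantile F (exp y) = c * exp (\<gamma> * y + (LBINT u:{0..y}. \<zeta> u))" if y: "0 < y" for y
  proof -
    \<comment> \<open>Adding the endpoint \<open>exp 0 = 1\<close> changes nothing, since
      \<open>\<eta>'\<close> is 0 there.\<close>
    have \<eta>'_eq: "indicator {1<..exp y} s *\<^sub>R (\<eta> s / s) = indicator {exp 0..exp y} s *\<^sub>R (\<eta>' s / s)" for s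
      by (auto simp: \<eta>'_def split: split_indicator)
    have "set_integrable lborel {1<..exp y} (\<lambda>s. \<eta> s / s)"
      using assms(1) y by (simp add: von_mises_def)
    then have "set_integrable lborel {exp 0..exp y} (\<lambda>s. \<eta>' s / s)"
      unfolding set_integrable_def \<eta>'_eq .
    \<comment> \<open>The substitution s = exp u turns the measure ds / s into du.\<close>
    then have "(LBINT s. (\<eta>' s / s) * indicator {exp 0..exp y} s) = (LBINT u. (\<eta>' (exp u) / exp u) * exp u * indicator {0..y} u)"
      using y by (intro integral_substitution(2)) (auto intro!: derivative_eq_intros continuous_intros)
    then have "(LBINT s:{1<..exp y}. \<eta> s / s) = (LBINT u:{0..y}. \<zeta> u)"
      unfolding set_lebesgue_integral_def \<eta>'_eq by (simp add: \<zeta> mult.commute)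
    then show ?thesis
      using c(2)[of "exp y"] y by (simp add: powr_def exp_add)
  qed
  then show "\<exists>c>0. \<forall>y>0. tail_quantile F (exp y) = c * exp (\<gamma> * y + (LBINT u:{0..y}. \<zeta> u))"
    using c(1) by blast
qed

lemma bounded_rate_eta_bar:
  assumes "von_mises F \<gamma> \<eta>" and bdd: "\<And>s. 1 < s \<Longrightarrow> \<bar>\<eta> s\<bar> \<le> K"
  shows "bounded_rate (\<lambda>u. if 0 < u then \<eta> (exp u) else 0) (\<lambda>u. eta_bar \<eta> (exp u)) K"
proof
  have bdd_above: "bdd_above ((\<lambda>s. \<bar>\<eta> s\<bar>) ` ({t..} \<inter> {1<..}))" for t
    using bdd by (intro bdd_aboveI2[of _ _ K]) auto
  \<comment> \<open>A point witnessing that the supremum ranges over a nonempty set, also when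
    \<open>t\<close> lies below the domain of \<eta>.\<close>
  have mem: "max t 2 \<in> {t..} \<inter> {1<..}" for t :: real
    by auto
  show "eta_bar \<eta> (exp v) \<le> eta_bar \<eta> (exp u)" if "u \<le> v" for u v
    unfolding eta_bar_def
  proof (rule cSUP_subset_mono)
    show "{exp v..} \<inter> {1<..} \<noteq> {}" using mem[of "exp v"] by blast
    show "{exp v..} \<inter> {1<..} \<subseteq> {exp u..} \<inter> {1<..}"
      using that by (auto intro: order.trans[rotated])
  qed (use bdd_above in auto)
  show "\<bar>if 0 < u then \<eta> (exp u) else 0\<bar> \<le> eta_bar \<eta> (exp u)" for u
  proof (cases "0 < u")
    case True
    then show ?thesis
      unfolding eta_bar_def using bdd_above by (auto intro!: cSUP_upper)
  next
    case False
    have "0 \<le> \<bar>\<eta> (max (exp u) 2)\<bar>" by simp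
    also have "\<dots> \<le> eta_bar \<eta> (exp u)"
      unfolding eta_bar_def using bdd_above mem by (intro cSUP_upper)
    finally show ?thesis using False by simp
  qed
  show "eta_bar \<eta> (exp u) \<le> K" for u
  proof -
    have "{exp u..} \<inter> {1<..} \<noteq> {}"
      using mem[of "exp u"] by blast
    then show ?thesis
      unfolding eta_bar_def using bdd by (intro cSUP_least) auto
  qed
qed (use von_mises_log_quantile(1)[OF assms(1)] in auto)

text \<open>Allows samples on different probability spaces to be compared: a measurable statistic
  has a law determined by the joint law of the sample.\<close>

lemma distr_sample_statistic:
  assumes "distr M (\<Pi>\<^sub>M i\<in>{..<n}. borel) (\<lambda>\<omega>. \<lambda>i\<in>{..<n}. X i \<omega>) = (\<Pi>\<^sub>M i\<in>{..<n}. \<rho>)"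
    and [measurable]: "\<And>i. i < n \<Longrightarrow> X i \<in> borel_measurable M"
    and sets: "sets \<rho> = sets borel"
    and \<Psi> [measurable]: "\<Psi> \<in> borel_measurable (\<Pi>\<^sub>M i\<in>{..<n}. (borel :: real measure))"
    and g: "\<And>\<omega>. g \<omega> = \<Psi> (\<lambda>i\<in>{..<n}. X i \<omega>)"
  shows "distr M borel g = distr (\<Pi>\<^sub>M i\<in>{..<n}. \<rho>) borel \<Psi>"
proof -
  have [measurable]: "(\<lambda>\<omega>. \<lambda>i\<in>{..<n}. X i \<omega>) \<in> M \<rightarrow>\<^sub>M (\<Pi>\<^sub>M i\<in>{..<n}. borel)"
    by (rule measurable_restrict) auto
  have "distr M borel g = distr (distr M (\<Pi>\<^sub>M i\<in>{..<n}. borel) (\<lambda>\<omega>. \<lambda>i\<in>{..<n}. X i \<omega>)) borel \<Psi>"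
    unfolding g[THEN ext] by (subst distr_distr) (auto simp: comp_def)
  then show ?thesis
    by (simp add: assms(1))
qed

lemma order_stat_restrict:
  "order_stat n X j \<omega> = order_stat n (\<lambda>i x. x i) j (\<lambda>i\<in>{..<n}. X i \<omega>)"
  unfolding order_stat_def by (intro arg_cong[where f = "\<lambda>xs. rev (sort xs) ! (j - 1)"]) simp

lemma hill_restrict: "hill n X k \<omega> = hill n (\<lambda>i x. x i) k (\<lambda>i\<in>{..<n}. X i \<omega>)"
  unfolding hill_def by (simp flip: order_stat_restrict)

lemma measurable_hill:
  assumes "\<And>i. i < n \<Longrightarrow> X i \<in> borel_measurable M" "k < n"
  shows "hill n X k \<in> borel_measurable M"
proof -
  have [measurable]: "order_stat n X (k + 1) \<in> borel_measurable M"
    using assms by (intro measurable_order_stat) auto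
  have [measurable]: "order_stat n X l \<in> borel_measurable M" if "l \<in> {1..k}" for l
    using assms that by (intro measurable_order_stat) auto
  show ?thesis
    unfolding hill_def[abs_def] by measurable
qed

theorem proposition3p1:
  fixes F \<eta> :: "real \<Rightarrow> real" and \<gamma> :: real and n k :: nat
    and M :: "'a measure" and X :: "nat \<Rightarrow> 'a \<Rightarrow> real"
    and N :: "'b measure" and Y :: "nat \<Rightarrow> 'b \<Rightarrow> real"
  assumes "\<gamma> > 0" and "MDA \<gamma> F"
    and "von_mises F \<gamma> \<eta>" and "bounded (\<eta> ` {1<..})"
    and "1 \<le> k" and "k < n"
    and "prob_space M"
    and "prob_space.indep_vars M (\<lambda>_. borel) X {..<n}"
    and "\<And>i. i < n \<Longrightarrow> cdf (distr M borel (X i)) = F"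
    and "prob_space N"
    and "prob_space.indep_vars N (\<lambda>_. borel) Y {..<n}"
    and "\<And>i. i < n \<Longrightarrow> distributed N lborel (Y i) (exponential_density 1)"
  shows "integrable M (hill n X k) \<and> integrable M (\<lambda>\<omega>. (hill n X k \<omega>)\<^sup>2) \<and>
    - (2 * \<gamma> / real k) *
        prob_space.expectation N (\<lambda>\<omega>. eta_bar \<eta> (exp (order_stat n Y (k + 1) \<omega>)))
      \<le> prob_space.variance M (hill n X k) - \<gamma>\<^sup>2 / real k \<and>
    prob_space.variance M (hill n X k) - \<gamma>\<^sup>2 / real k
      \<le> 2 * \<gamma> / real k *
          prob_space.expectation N (\<lambda>\<omega>. eta_bar \<eta> (exp (order_stat n Y (k + 1) \<omega>)))
        + 5 / real k *
          prob_space.expectation N (\<lambda>\<omega>. (eta_bar \<eta> (exp (order_stat n Y (k + 1) \<omega>)))\<^sup>2)"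
proof -
  interpret M: prob_space M by fact
  interpret N: prob_space N by fact
  interpret P: prob_space "exp_sample n" by (rule prob_space_exp_sample)
  have n: "{..<n} \<noteq> {}"
    using assms(6) by auto
  have X [measurable]: "X i \<in> borel_measurable M" if "i < n" for i
    using assms(8) that by (auto simp: M.indep_vars_def)
  have Y [measurable]: "Y i \<in> borel_measurable N" if "i < n" for i
    using assms(11) that by (auto simp: N.indep_vars_def)
  define \<rho> where "\<rho> = distr M borel (X 0)"
  have \<rho>: "real_distribution \<rho>"
    unfolding \<rho>_def using assms(6) by (intro M.real_distribution_distr X) auto
  have cdf_\<rho>: "cdf \<rho> = F"
    unfolding \<rho>_def using assms(6) by (intro assms(9)) auto
  have distr_X: "distr M borel (X i) = \<rho>" if "i < n" for i
    using that \<rho> cdf_\<rho> assms(9)[OF that] by (intro cdf_unique M.real_distribution_distr X) auto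
  obtain K where K: "\<And>s. 1 < s \<Longrightarrow> \<bar>\<eta> s\<bar> \<le> K"
    using assms(4) by (auto simp: bounded_iff)
  interpret bounded_rate "\<lambda>u. if 0 < u then \<eta> (exp u) else 0" "\<lambda>u. eta_bar \<eta> (exp u)" K
    using assms(3) K by (rule bounded_rate_eta_bar)
  obtain c where c: "c > 0" "\<And>y. 0 < y \<Longrightarrow> tail_quantile F (exp y) = c * exp (\<gamma> * y + G y)"
    using von_mises_log_quantile(2)[OF assms(3)] unfolding G_def by blast
  \<comment> \<open>The formula is used on the whole line, which makes \<open>H\<close> measurable
    and positive everywhere; it agrees with the quantile function at positive arguments.\<close>
  define H where "H y = c * exp (\<gamma> * y + G y)" for y
  have H_meas [measurable]: "H \<in> borel_measurable borel"
    unfolding H_def by measurable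
  have H_pos: "0 < H y" for y
    using c(1) by (simp add: H_def)
  have distr_H: "distr std_exp borel H = \<rho>"
    using \<rho> by (rule distr_tail_quantile_exp) (simp_all add: cdf_\<rho> c(2) H_def)
  \<comment> \<open>Monotonicity is inherited from the quantile function; the formula does not show
    it by itself, as \<eta> is not assumed to stay above -\<gamma>.\<close>
  have mono_H: "mono_on {0<..} H"
  proof (rule mono_onI)
    fix x y :: real assume "x \<in> {0<..}" "y \<in> {0<..}" "x \<le> y"
    then show "H x \<le> H y"
      using tail_quantile_mono[OF \<rho>, of "exp x" "exp y"] by (simp add: cdf_\<rho> c(2) H_def)
  qed
  define hv where "hv = hill n (\<lambda>i x. x i) k"
  have hv [measurable]: "hv \<in> borel_measurable (\<Pi>\<^sub>M i\<in>{..<n}. borel)"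
    unfolding hv_def using assms(6) by (intro measurable_hill) auto
  have distr_hill_X: "distr M borel (hill n X k) = distr (\<Pi>\<^sub>M i\<in>{..<n}. \<rho>) borel hv"
  proof (rule distr_sample_statistic)
    show "distr M (\<Pi>\<^sub>M i\<in>{..<n}. borel) (\<lambda>\<omega>. \<lambda>i\<in>{..<n}. X i \<omega>) = (\<Pi>\<^sub>M i\<in>{..<n}. \<rho>)"
      using distr_X by (intro distr_sample_PiM assms(7,8) n) auto
    show "hill n X k \<omega> = hv (\<lambda>i\<in>{..<n}. X i \<omega>)" for \<omega>
      unfolding hv_def by (rule hill_restrict)
  qed (use X \<rho> in \<open>auto simp: real_distribution.events_eq_borel\<close>)
  \<comment> \<open>The given sample is not written as a function of exponentials; its Hill
    estimator only has the same law as that of the transformed exponential sample.\<close>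
  have distr_hill_H: "distr (exp_sample n) borel (hill n (\<lambda>i x. H (x i)) k) = distr (\<Pi>\<^sub>M i\<in>{..<n}. \<rho>) borel hv"
  proof (rule distr_sample_statistic)
    have "P.indep_vars (\<lambda>_. std_exp) (\<lambda>i x. x i) {..<n}"
      using n by (intro indep_vars_PiM_coordinates prob_space_std_exp)
    then have "P.indep_vars (\<lambda>_. borel) (\<lambda>i x. H (x i)) {..<n}"
      by (rule P.indep_vars_compose2) simp
    moreover have "distr (exp_sample n) borel (\<lambda>x. H (x i)) = \<rho>" if "i \<in> {..<n}" for i
    proof -
      have "distr (exp_sample n) borel (\<lambda>x. H (x i)) = distr (distr (exp_sample n) std_exp (\<lambda>x. x i)) borel H"
        using that by (subst distr_distr) (auto simp: comp_def)
      also have "distr (exp_sample n) std_exp (\<lambda>x. x i) = std_exp"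
        using that prob_space_std_exp by (intro distr_PiM_component)
      finally show ?thesis by (simp add: distr_H)
    qed
    ultimately show "distr (exp_sample n) (\<Pi>\<^sub>M i\<in>{..<n}. borel) (\<lambda>\<omega>. \<lambda>i\<in>{..<n}. H (\<omega> i)) = (\<Pi>\<^sub>M i\<in>{..<n}. \<rho>)"
      using n by (intro distr_sample_PiM prob_space_exp_sample) auto
    show "hill n (\<lambda>i x. H (x i)) k \<omega> = hv (\<lambda>i\<in>{..<n}. H (\<omega> i))" for \<omega>
      unfolding hv_def by (rule hill_restrict)
    show "(\<lambda>x. H (x i)) \<in> borel_measurable (exp_sample n)" if "i < n" for i
      using that by simp
  qed (use \<rho> in \<open>auto simp: real_distribution.events_eq_borel\<close>)
  have hill_H_meas: "hill n (\<lambda>i x. H (x i)) k \<in> borel_measurable (exp_sample n)"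
    using assms(6) by (intro measurable_hill) auto
  have hill_X_meas: "hill n X k \<in> borel_measurable M"
    using assms(6) by (intro measurable_hill X) auto
  have hill_H: "AE x in exp_sample n. hill n (\<lambda>i x. H (x i)) k x = excess \<gamma> n k x / real k"
  proof -
    have "AE x in exp_sample n. \<forall>i\<in>{..<n}. 0 < x i"
    proof (rule AE_finite_allI)
      show "AE x in exp_sample n. 0 < x i" if "i \<in> {..<n}" for i
        using prob_space_std_exp that AE_std_exp_pos by (rule AE_PiM_component)
    qed simp
    then show ?thesis
    proof eventually_elim
      case (elim x)
      have os: "order_stat n (\<lambda>i x. H (x i)) j x = H (exp_order_stat n j x)" if "1 \<le> j" "j \<le> n" for j
        using elim that by (intro order_stat_mono_map[OF mono_H, of n "\<lambda>i x. x i"]) auto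
      have "ln (order_stat n (\<lambda>i x. H (x i)) l x / order_stat n (\<lambda>i x. H (x i)) (k + 1) x)
          = \<gamma> * (exp_order_stat n l x - exp_order_stat n (k + 1) x) + (G (exp_order_stat n l x) - G (exp_order_stat n (k + 1) x))"
        if "l \<in> {1..k}" for l
      proof -
        \<comment> \<open>The constant \<open>c\<close> cancels here.\<close>
        have "ln (H a / H b) = \<gamma> * (a - b) + (G a - G b)" for a b
          using c(1) by (simp add: H_def algebra_simps flip: exp_diff)
        then show ?thesis
          using that assms(6) os by simp
      qed
      then show ?case
        unfolding hill_def excess_def by simp
    qed
  qed
  have transfer: "distr M borel (hill n X k) = distr (exp_sample n) borel (\<lambda>x. excess \<gamma> n k x / real k)"
  proof -
    have "distr M borel (hill n X k) = distr (exp_sample n) borel (hill n (\<lambda>i x. H (x i)) k)"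
      by (simp add: distr_hill_X distr_hill_H)
    also have "\<dots> = distr (exp_sample n) borel (\<lambda>x. excess \<gamma> n k x / real k)"
      using hill_H hill_H_meas measurable_excess[OF assms(6)] by (intro distr_cong_AE) auto
    finally show ?thesis .
  qed
  have ex_meas [measurable]: "excess \<gamma> n k \<in> borel_measurable (exp_sample n)"
    using assms(6) by (rule measurable_excess)
  have E_transfer: "integrable M (\<lambda>\<omega>. f (hill n X k \<omega>)) \<longleftrightarrow> integrable (exp_sample n) (\<lambda>x. f (excess \<gamma> n k x / real k))"
    "M.expectation (\<lambda>\<omega>. f (hill n X k \<omega>)) = P.expectation (\<lambda>x. f (excess \<gamma> n k x / real k))"
    if [measurable]: "f \<in> borel_measurable borel" for f :: "real \<Rightarrow> real"
    using transfer integrable_distr_eq[OF hill_X_meas that] integral_distr[OF hill_X_meas that]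
      integrable_distr_eq[of "\<lambda>x. excess \<gamma> n k x / real k" "exp_sample n" borel f]
      integral_distr[of "\<lambda>x. excess \<gamma> n k x / real k" "exp_sample n" borel f]
    by auto
  have distr_T: "distr N borel (order_stat n Y (k + 1)) = order_law n k"
  proof -
    have "distr N borel (Y i) = std_exp" if "i \<in> {..<n}" for i
      using assms(12)[of i] that by (simp add: distributed_def) (metis distr_cong sets_lborel)
    then have "distr N (\<Pi>\<^sub>M i\<in>{..<n}. borel) (\<lambda>\<omega>. \<lambda>i\<in>{..<n}. Y i \<omega>) = exp_sample n"
      using n by (intro distr_sample_PiM assms(10,11)) auto
    then have "distr N borel (order_stat n Y (k + 1)) = distr (exp_sample n) borel (exp_order_stat n (k + 1))"
    proof (rule distr_sample_statistic)
      show "exp_order_stat n (k + 1) \<in> borel_measurable (\<Pi>\<^sub>M i\<in>{..<n}. borel)"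
        using assms(6) by (intro measurable_order_stat) auto
    qed (use Y order_stat_restrict in auto)
    then show ?thesis
      using distr_exp_order_stat[OF assms(6)] by simp
  qed
  have T_meas: "order_stat n Y (k + 1) \<in> borel_measurable N"
    using assms(6) by (intro measurable_order_stat Y) auto
  have E_T: "N.expectation (\<lambda>\<omega>. f (order_stat n Y (k + 1) \<omega>)) = (\<integral>t. f t \<partial>order_law n k)"
    if "f \<in> borel_measurable borel" for f :: "real \<Rightarrow> real"
    using integral_distr[OF T_meas that] distr_T by simp
  have "integrable M (hill n X k)"
    using E_transfer(1)[of "\<lambda>h. h"] excess_moments(1)[OF assms(6), of \<gamma>] assms(1) by simp
  moreover have "integrable M (\<lambda>\<omega>. (hill n X k \<omega>)\<^sup>2)"
    using E_transfer(1)[of "\<lambda>h. h\<^sup>2"] excess_moments(2)[OF assms(6), of \<gamma>] assms(1) by (simp add: power_divide)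
  \<comment> \<open>The transfer is applied twice: to the identity for the mean, then to the squared
    deviation from that mean.\<close>
  moreover have "M.variance (hill n X k) = P.variance (\<lambda>x. excess \<gamma> n k x / real k)"
    using E_transfer(2)[of "\<lambda>h. h"] E_transfer(2)[of "\<lambda>h. (h - M.expectation (hill n X k))\<^sup>2"] by simp
  ultimately show ?thesis
    using variance_excess_bounds[OF assms(5,6), of \<gamma>] assms(1)
      E_T[of "\<lambda>t. eta_bar \<eta> (exp t)"] E_T[of "\<lambda>t. (eta_bar \<eta> (exp t))\<^sup>2"]
    by simp
qed

end
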